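(* Let $M$ be a tame matroid (possibly infinite). Then the following are equivalent. (1) $M$ is a thin sums matroid over every field. (2) $M$ is signable. (3) Every finite minor of $M$ is regular.
   Context: Matroids may be infinite, in the following sense: a matroid on a set $E$ is given by a family $\mathcal{I}\subseteq\mathcal{P}(E)$ of independent sets such that (I1) $\emptyset\in\mathcal{I}$; (I2) $\mathcal{I}$ is closed under subsets; (I3) whenever $I,I'\in\mathcal{I}$ with $I'$ maximal and $I$ not maximal, there is $x\in I'\setminus I$ with $I\cup\{x\}\in\mathcal{I}$; (IM) whenever $I\subseteq X\subseteq E$ and $I\in\mathcal{I}$, the set $\{I'\in\mathcal{I}\mid I\subseteq I'\subseteq X\}$ has a maximal element. Bases are maximal independent sets, circuits are minimal dependent sets; the dual $M^*$ has as bases the complements of bases of $M$, and cocircuits of $M$ are circuits of $M^*$. Deletion $M\backslash D$ has as independent sets the independent sets of $M$ disjoint from $D$; contraction is $M/C=(M^*\backslash C)^*$; minors are matroids $M/C\backslash D$ with $C,D$ disjoint; a minor is finite if its ground set is finite. A matroid is tame if every intersection of a circuit with a cocircuit is finite. A finite matroid is regular if it is representable over every field, i.e. for every field $k$ it is the matroid of linear independence of some family of vectors (indexed by its ground set) in a $k$-vector space. Thin sums matroids over a field $k$: let $A$ be a set and $f=(f_e\mid e\in E)$ a family of functions $A\to k$. A family $\lambda=(\lambda_e\mid e\in E)$ of elements of $k$ is a thin dependence of $f$ if for each $a\in A$ we have $\sum_{e\in E}\lambda_e f_e(a)=0$, where this includes the requirement that only finitely many summands are nonzero. A set $I\subseteq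 E$ is thinly independent for $f$ if the only thin dependence of $f$ that is $0$ everywhere outside $I$ is the zero family. A matroid $M$ on $E$ is a thin sums matroid over $k$ if there are such $A$ and $f$ for which the independent sets of $M$ are precisely the thinly independent sets for $f$. A signing of $M$ is a choice of a function $c_o\colon o\to\{1,-1\}$ for each circuit $o$ of $M$ and a function $d_b\colon b\to\{1,-1\}$ for each cocircuit $b$ of $M$ such that for every circuit $o$ and cocircuit $b$ we have $\sum_{e\in o\cap b}c_o(e)d_b(e)=0$, where the sum is evaluated in $\mathbb{Z}$ (and the equation includes the requirement that only finitely many summands are nonzero). $M$ is signable if it has a signing. *)

theory Defs
  imports "HOL-Algebra.Module"
begin

section \<open>Possibly infinite matroids\<close>

record 'e set_system =
  ground :: "'e set"
  indep :: "'e set set"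

definition maximal_in :: "'e set set \<Rightarrow> 'e set \<Rightarrow> bool" where
  "maximal_in \<F> X \<longleftrightarrow> X \<in> \<F> \<and> (\<forall>Y\<in>\<F>. X \<subseteq> Y \<longrightarrow> Y = X)"

definition minimal_in :: "'e set set \<Rightarrow> 'e set \<Rightarrow> bool" where
  "minimal_in \<F> X \<longleftrightarrow> X \<in> \<F> \<and> (\<forall>Y\<in>\<F>. Y \<subseteq> X \<longrightarrow> Y = X)"

locale matroid =
  fixes M :: "'e set_system"
  assumes indep_ground: "indep M \<subseteq> Pow (ground M)"
    and I1: "{} \<in> indep M"
    and I2: "I \<in> indep M \<Longrightarrow> J \<subseteq> I \<Longrightarrow> J \<in> indep M"
    and I3: "I \<in> indep M \<Longrightarrow> \<not> maximal_in (indep M) I \<Longrightarrow> maximal_in (indep M) I' \<Longrightarrow>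
      \<exists>x\<in>I' - I. insert x I \<in> indep M"
    and IM: "I \<in> indep M \<Longrightarrow> I \<subseteq> X \<Longrightarrow> X \<subseteq> ground M \<Longrightarrow>
      \<exists>J. maximal_in {I'\<in>indep M. I \<subseteq> I' \<and> I' \<subseteq> X} J"

definition bases :: "'e set_system \<Rightarrow> 'e set set" where
  "bases M = {B. maximal_in (indep M) B}"

definition circuits :: "'e set_system \<Rightarrow> 'e set set" where
  "circuits M = {C. minimal_in {X. X \<subseteq> ground M \<and> X \<notin> indep M} C}"

text \<open>By (IM) and (I2), the independent sets of a matroid are exactly the subsets of its bases;
  so this is the matroid whose bases are the complements of the bases of \<open>M\<close>.\<close>

definition dual :: "'e set_system \<Rightarrow> 'e set_system" where
  "dual M = \<lparr>ground = ground M, indep = {I. \<exists>B\<in>bases M. I \<subseteq> ground M - B}\<rparr>"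

definition cocircuits :: "'e set_system \<Rightarrow> 'e set set" where
  "cocircuits M = circuits (dual M)"

definition deletion :: "'e set_system \<Rightarrow> 'e set \<Rightarrow> 'e set_system" where
  "deletion M D = \<lparr>ground = ground M - D, indep = {I \<in> indep M. I \<inter> D = {}}\<rparr>"

definition contraction :: "'e set_system \<Rightarrow> 'e set \<Rightarrow> 'e set_system" where
  "contraction M C = dual (deletion (dual M) C)"

definition is_minor :: "'e set_system \<Rightarrow> 'e set_system \<Rightarrow> bool" where
  "is_minor N M \<longleftrightarrow> (\<exists>C D. C \<subseteq> ground M \<and> D \<subseteq> ground M \<and> C \<inter> D = {} \<and>
     N = deletion (contraction M C) D)"

definition tame :: "'e set_system \<Rightarrow> bool" where
  "tame M \<longleftrightarrow> (\<forall>C\<in>circuits M. \<forall>D\<in>cocircuits M. finite (C \<inter> D))"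


section \<open>Signings\<close>

text \<open>The values of \<open>c C\<close> outside \<open>C\<close> and of \<open>d D\<close> outside \<open>D\<close> are irrelevant. No summand
  vanishes, so requiring finitely many nonzero summands amounts to \<open>C \<inter> D\<close> being finite.\<close>

definition signing :: "'e set_system \<Rightarrow> ('e set \<Rightarrow> 'e \<Rightarrow> int) \<Rightarrow> ('e set \<Rightarrow> 'e \<Rightarrow> int) \<Rightarrow> bool" where
  "signing M c d \<longleftrightarrow>
     (\<forall>C\<in>circuits M. \<forall>e\<in>C. c C e \<in> {1, -1}) \<and>
     (\<forall>D\<in>cocircuits M. \<forall>e\<in>D. d D e \<in> {1, -1}) \<and>
     (\<forall>C\<in>circuits M. \<forall>D\<in>cocircuits M.
        finite (C \<inter> D) \<and> (\<Sum>e\<in>C \<inter> D. c C e * d D e) = 0)"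

definition signable :: "'e set_system \<Rightarrow> bool" where
  "signable M \<longleftrightarrow> (\<exists>c d. signing M c d)"


section \<open>Thin sums matroids\<close>

definition thin_dependence ::
  "'k ring \<Rightarrow> 'e set \<Rightarrow> 'a set \<Rightarrow> ('e \<Rightarrow> 'a \<Rightarrow> 'k) \<Rightarrow> ('e \<Rightarrow> 'k) \<Rightarrow> bool" where
  "thin_dependence k E A f l \<longleftrightarrow> l \<in> E \<rightarrow> carrier k \<and>
     (\<forall>a\<in>A. finite {e\<in>E. l e \<otimes>\<^bsub>k\<^esub> f e a \<noteq> \<zero>\<^bsub>k\<^esub>} \<and>
        (\<Oplus>\<^bsub>k\<^esub>e\<in>{e\<in>E. l e \<otimes>\<^bsub>k\<^esub> f e a \<noteq> \<zero>\<^bsub>k\<^esub>}. l e \<otimes>\<^bsub>k\<^esub> f e a) = \<zero>\<^bsub>k\<^esub>)"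

definition thinly_independent ::
  "'k ring \<Rightarrow> 'e set \<Rightarrow> 'a set \<Rightarrow> ('e \<Rightarrow> 'a \<Rightarrow> 'k) \<Rightarrow> 'e set \<Rightarrow> bool" where
  "thinly_independent k E A f I \<longleftrightarrow> I \<subseteq> E \<and>
     (\<forall>l. thin_dependence k E A f l \<and> (\<forall>e\<in>E - I. l e = \<zero>\<^bsub>k\<^esub>) \<longrightarrow> (\<forall>e\<in>E. l e = \<zero>\<^bsub>k\<^esub>))"

text \<open>HOL cannot quantify over the type of the elements of \<open>A\<close>. Taking \<open>A\<close> among the functions
  from \<open>'e\<close> to \<open>'k\<close> is no restriction, since an element \<open>a\<close> enters only through the function
  \<open>\<lambda>e. f e a\<close>: see \<open>thin_sums_overI\<close>.\<close>

definition thin_sums_over :: "'k ring \<Rightarrow> 'e set_system \<Rightarrow> bool" where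
  "thin_sums_over k M \<longleftrightarrow>
     (\<exists>(A :: ('e \<Rightarrow> 'k) set) f. (\<forall>e\<in>ground M. \<forall>a\<in>A. f e a \<in> carrier k) \<and>
        indep M = {I. thinly_independent k (ground M) A f I})"

lemma thin_sums_overI:
  fixes M :: "'e set_system" and A :: "'a set" and f :: "'e \<Rightarrow> 'a \<Rightarrow> 'k"
  assumes "\<forall>e\<in>ground M. \<forall>a\<in>A. f e a \<in> carrier k"
    and "indep M = {I. thinly_independent k (ground M) A f I}"
  shows "thin_sums_over k M"
proof -
  have "thinly_independent k (ground M) ((\<lambda>a e. f e a) ` A) (\<lambda>e r. r e) =
      thinly_independent k (ground M) A f"
    by (simp add: fun_eq_iff thinly_independent_def thin_dependence_def)
  then show ?thesis
    using assms unfolding thin_sums_over_def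
    by (intro exI[of _ "(\<lambda>a e. f e a) ` A"] exI[of _ "\<lambda>e r. r e"]) auto
qed


section \<open>Regular finite matroids\<close>

definition linearly_independent ::
  "'k ring \<Rightarrow> ('k, 'v) module \<Rightarrow> ('e \<Rightarrow> 'v) \<Rightarrow> 'e set \<Rightarrow> bool" where
  "linearly_independent k V v I \<longleftrightarrow>
     (\<forall>J c. J \<subseteq> I \<and> finite J \<and> c \<in> J \<rightarrow> carrier k \<and>
        (\<Oplus>\<^bsub>V\<^esub>e\<in>J. c e \<odot>\<^bsub>V\<^esub> v e) = \<zero>\<^bsub>V\<^esub> \<longrightarrow> (\<forall>e\<in>J. c e = \<zero>\<^bsub>k\<^esub>))"

text \<open>For finite \<open>M\<close>, the type of the vectors is no restriction either, because the span of the
  family injects into it: see \<open>representable_overI\<close>. The qualified name avoids the locale of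
  modules over type-class rings.\<close>

definition representable_over :: "'k ring \<Rightarrow> 'e set_system \<Rightarrow> bool" where
  "representable_over k M \<longleftrightarrow>
     (\<exists>(V :: ('k, 'e \<Rightarrow> 'k) module) v. Module.module k V \<and> v \<in> ground M \<rightarrow> carrier V \<and>
        indep M = {I. I \<subseteq> ground M \<and> linearly_independent k V v I})"

lemma representable_overI:
  fixes M :: "'e set_system" and k :: "'k ring" and V :: "('k, 'v) module"
  assumes fin: "finite (ground M)"
    and V: "Module.module k V"
    and v: "v \<in> ground M \<rightarrow> carrier V"
    and ind: "indep M = {I. I \<subseteq> ground M \<and> linearly_independent k V v I}"
  shows "representable_over k M"
proof -
  interpret V: Module.module k V by (fact V)
  let ?E = "ground M"
  define comb where "comb c = (\<Oplus>\<^bsub>V\<^esub>e\<in>?E. c e \<odot>\<^bsub>V\<^esub> v e)" for c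
  define S where "S = comb ` (?E \<rightarrow> carrier k)"
  define \<phi> where "\<phi> = inv_into (?E \<rightarrow> carrier k) comb"
  have v': "v e \<in> carrier V" if "e \<in> ?E" for e using v that by auto
  have inj: "inj_on \<phi> S" unfolding \<phi>_def S_def by (rule inj_on_inv_into) simp
  have comb_add: "comb c \<oplus>\<^bsub>V\<^esub> comb d = comb (\<lambda>e. c e \<oplus>\<^bsub>k\<^esub> d e)"
    if "c \<in> ?E \<rightarrow> carrier k" "d \<in> ?E \<rightarrow> carrier k" for c d
  proof -
    have "comb (\<lambda>e. c e \<oplus>\<^bsub>k\<^esub> d e) = (\<Oplus>\<^bsub>V\<^esub>e\<in>?E. c e \<odot>\<^bsub>V\<^esub> v e \<oplus>\<^bsub>V\<^esub> d e \<odot>\<^bsub>V\<^esub> v e)"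
      unfolding comb_def using that v'
      by (intro V.M.finsum_cong') (auto simp: Pi_iff V.smult_l_distr)
    also have "\<dots> = comb c \<oplus>\<^bsub>V\<^esub> comb d"
      unfolding comb_def using that v' by (intro V.M.finsum_addf) (auto simp: Pi_iff)
    finally show ?thesis ..
  qed
  have comb_smult: "a \<odot>\<^bsub>V\<^esub> comb c = comb (\<lambda>e. a \<otimes>\<^bsub>k\<^esub> c e)"
    if "a \<in> carrier k" "c \<in> ?E \<rightarrow> carrier k" for a c
  proof -
    have "a \<odot>\<^bsub>V\<^esub> comb c = (\<Oplus>\<^bsub>V\<^esub>e\<in>?E. a \<odot>\<^bsub>V\<^esub> (c e \<odot>\<^bsub>V\<^esub> v e))"
      unfolding comb_def using that v' by (intro V.finsum_smult_ldistr fin) (auto simp: Pi_iff)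
    also have "\<dots> = comb (\<lambda>e. a \<otimes>\<^bsub>k\<^esub> c e)"
      unfolding comb_def using that v'
      by (intro V.M.finsum_cong') (auto simp: Pi_iff V.smult_assoc1)
    finally show ?thesis .
  qed
  have S_sub: "S \<subseteq> carrier V"
    unfolding S_def comb_def using v' by (auto simp: Pi_iff intro!: V.M.finsum_closed)
  have S_add: "x \<oplus>\<^bsub>V\<^esub> y \<in> S" if "x \<in> S" "y \<in> S" for x y
    using that unfolding S_def by (auto simp: comb_add Pi_iff intro!: imageI)
  have S_smult: "a \<odot>\<^bsub>V\<^esub> x \<in> S" if "a \<in> carrier k" "x \<in> S" for a x
    using that unfolding S_def by (auto simp: comb_smult Pi_iff intro!: imageI)
  have "comb (\<lambda>e. \<zero>\<^bsub>k\<^esub>) = (\<Oplus>\<^bsub>V\<^esub>e\<in>?E. \<zero>\<^bsub>V\<^esub>)"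
    unfolding comb_def using v' by (intro V.M.finsum_cong') auto
  then have S_zero: "\<zero>\<^bsub>V\<^esub> \<in> S"
    unfolding S_def by (intro image_eqI[of _ _ "\<lambda>e. \<zero>\<^bsub>k\<^esub>"]) auto
  have S_v: "v e \<in> S" if e: "e \<in> ?E" for e
  proof -
    let ?c = "\<lambda>x. if x = e then \<one>\<^bsub>k\<^esub> else \<zero>\<^bsub>k\<^esub>"
    have "comb ?c = (\<Oplus>\<^bsub>V\<^esub>x\<in>?E. if e = x then v x else \<zero>\<^bsub>V\<^esub>)"
      unfolding comb_def using v' by (intro V.M.finsum_cong') auto
    also have "\<dots> = v e"
      using V.M.add.finprod_singleton[OF e fin, of v] v' by auto
    finally show ?thesis unfolding S_def by (intro image_eqI[of _ _ ?c]) auto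
  qed
  define \<psi> where "\<psi> = inv_into S \<phi>"
  have \<psi>\<phi>: "\<psi> (\<phi> x) = x" if "x \<in> S" for x
    unfolding \<psi>_def using inj that by (rule inv_into_f_f)
  define W :: "('k, 'e \<Rightarrow> 'k) module" where
    "W = \<lparr>carrier = \<phi> ` S, monoid.mult = undefined, one = undefined, zero = \<phi> \<zero>\<^bsub>V\<^esub>,
      add = (\<lambda>x y. \<phi> (\<psi> x \<oplus>\<^bsub>V\<^esub> \<psi> y)), smult = (\<lambda>a x. \<phi> (a \<odot>\<^bsub>V\<^esub> \<psi> x))\<rparr>"
  have carrier_W: "carrier W = \<phi> ` S" and zero_W: "\<zero>\<^bsub>W\<^esub> = \<phi> \<zero>\<^bsub>V\<^esub>"
    by (simp_all add: W_def)
  have add_W: "\<phi> x \<oplus>\<^bsub>W\<^esub> \<phi> y = \<phi> (x \<oplus>\<^bsub>V\<^esub> y)" if "x \<in> S" "y \<in> S" for x y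
    using that by (simp add: W_def \<psi>\<phi>)
  have smult_W: "a \<odot>\<^bsub>W\<^esub> \<phi> x = \<phi> (a \<odot>\<^bsub>V\<^esub> x)" if "x \<in> S" for a x
    using that by (simp add: W_def \<psi>\<phi>)
  have S_V: "x \<in> carrier V" if "x \<in> S" for x using that S_sub by auto
  have W: "Module.module k W"
  proof (rule Module.moduleI)
    show "cring k" by (rule V.R.is_cring)
    show "abelian_group W"
    proof (rule abelian_groupI)
      fix x assume "x \<in> carrier W"
      then obtain s where s: "s \<in> S" "x = \<phi> s" by (auto simp: carrier_W)
      have "(\<ominus>\<^bsub>k\<^esub> \<one>\<^bsub>k\<^esub>) \<odot>\<^bsub>V\<^esub> s \<oplus>\<^bsub>V\<^esub> s = \<zero>\<^bsub>V\<^esub>"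
        using s S_V by (simp add: V.smult_l_minus V.M.l_neg)
      then show "\<exists>y\<in>carrier W. y \<oplus>\<^bsub>W\<^esub> x = \<zero>\<^bsub>W\<^esub>"
        using s S_smult by (intro bexI[of _ "\<phi> ((\<ominus>\<^bsub>k\<^esub> \<one>\<^bsub>k\<^esub>) \<odot>\<^bsub>V\<^esub> s)"])
          (auto simp: carrier_W zero_W add_W)
    qed (auto simp: carrier_W zero_W add_W S_add S_zero S_V V.M.a_assoc V.M.a_comm V.M.a_lcomm)
  qed (auto simp: carrier_W add_W smult_W S_add S_smult S_V
        V.smult_l_distr V.smult_r_distr V.smult_assoc1)
  interpret W: Module.module k W by (fact W)
  have sum_W: "finsum W (\<lambda>e. \<phi> (f e)) J = \<phi> (finsum V f J) \<and> finsum V f J \<in> S"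
    if "finite J" "f \<in> J \<rightarrow> S" for J :: "'e set" and f
    using that
  proof (induction J rule: finite_induct)
    case empty
    then show ?case by (simp add: zero_W S_zero)
  next
    case (insert x F)
    then have "f \<in> F \<rightarrow> carrier V" "f x \<in> carrier V" "(\<lambda>e. \<phi> (f e)) \<in> F \<rightarrow> carrier W"
        "\<phi> (f x) \<in> carrier W"
      using S_V by (auto simp: carrier_W)
    then show ?case using insert by (simp add: add_W S_add)
  qed
  have "linearly_independent k W (\<lambda>e. \<phi> (v e)) I = linearly_independent k V v I"
    if I: "I \<subseteq> ?E" for I
  proof -
    have "(\<Oplus>\<^bsub>W\<^esub>e\<in>J. c e \<odot>\<^bsub>W\<^esub> \<phi> (v e)) = \<zero>\<^bsub>W\<^esub> \<longleftrightarrow> (\<Oplus>\<^bsub>V\<^esub>e\<in>J. c e \<odot>\<^bsub>V\<^esub> v e) = \<zero>\<^bsub>V\<^esub>"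
      if J: "J \<subseteq> I" "finite J" "c \<in> J \<rightarrow> carrier k" for J c
    proof -
      have S: "(\<lambda>e. c e \<odot>\<^bsub>V\<^esub> v e) \<in> J \<rightarrow> S" using I J S_v S_smult by (auto simp: Pi_iff)
      have "(\<Oplus>\<^bsub>W\<^esub>e\<in>J. c e \<odot>\<^bsub>W\<^esub> \<phi> (v e)) = (\<Oplus>\<^bsub>W\<^esub>e\<in>J. \<phi> (c e \<odot>\<^bsub>V\<^esub> v e))"
        using I J S S_v by (intro W.M.finsum_cong') (auto simp: carrier_W smult_W Pi_iff)
      then show ?thesis
        using sum_W[OF J(2) S] inj S_zero by (auto simp: zero_W inj_on_eq_iff)
    qed
    then show ?thesis unfolding linearly_independent_def by blast
  qed
  then show ?thesis
    unfolding representable_over_def using W S_v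
    by (intro exI[of _ W] exI[of _ "\<lambda>e. \<phi> (v e)"]) (auto simp: carrier_W ind)
qed

text \<open>HOL cannot quantify over all fields inside a formula. Here ``every field'' means every field
  whose carrier is a set of elements of \<open>'k\<close>; finite carriers are included when \<open>'k\<close> is infinite.
  A type variable \<open>'k\<close> in a theorem makes this universe arbitrary, so that every given
  field has an isomorphic copy in some instance.\<close>

definition regular :: "'k itself \<Rightarrow> 'e set_system \<Rightarrow> bool" where
  "regular _ M \<longleftrightarrow>
     finite (ground M) \<and> (\<forall>k :: 'k ring. field k \<longrightarrow> representable_over k M)"

end

theory Submission
  imports Defs "HOL-Analysis.Function_Topology" "HOL-Library.Numeral_Type"
begin

text \<open>A signing represents \<open>M\<close> over every field, the rows being the signed cocircuits. Conversely, let \<open>M\<close>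
  be a thin sums matroid over a field \<open>k\<close> with two or three elements. Since \<open>M\<close> is tame, each circuit
  and each cocircuit carries a vector over \<open>k\<close> so that all these vectors are orthogonal: the vector
  of a cocircuit \<open>D\<close> is read off circuits that meet \<open>D\<close> in two elements, and orthogonality holds
  because the support of a thin dependence is a union of circuits, which is a compactness argument.
  Such families are inherited by minors. In a finite matroid the family over two elements says
  that circuits meet cocircuits evenly, and this turns the family over three elements into a signing
  over the integers. Finally, a tame matroid all of whose finite minors are signable is signable, by
  compactness: given finitely many circuits and cocircuits, some finite minor has circuits and
  cocircuits with the same pairwise intersections.\<close>

section \<open>Duality, circuits and minors of infinite matroids\<close>

text \<open>Signings are the notion that travels: they treat circuits and cocircuits alike, so
  deletion and contraction cost nothing, whereas dependences over a field do not visibly pass to a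
  contraction of an infinite matroid. The fields with two and three elements are chosen because
  their only nonzero elements are 1 and -1: a vector supported on a circuit is then already a choice
  of signs, correct modulo 2 or 3, and each nonzero entry is its own inverse. Neither modulus alone
  suffices, and even together they do not settle the integer identity one intersection at a time:
  six signs can add up to 6. Large intersections must be reduced to those of at most two elements,
  and parity supplies the circuits for this reduction. In an infinite matroid a circuit is not found
  by taking a smallest dependent set, and bases cannot be compared by counting. Most existence
  claims about circuits are therefore routed through the painting lemma.\<close>

context matroid
begin

lemma indep_subset_ground: "I \<in> indep M \<Longrightarrow> I \<subseteq> ground M"
  using indep_ground by auto

lemma basis_indep: "B \<in> bases M \<Longrightarrow> B \<in> indep M"
  by (simp add: bases_def maximal_in_def)

lemma basis_maximal: "B \<in> bases M \<Longrightarrow> I \<in> indep M \<Longrightarrow> B \<subseteq> I \<Longrightarrow> I = B"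
  by (simp add: bases_def maximal_in_def)

lemma augment:
  "I \<in> indep M \<Longrightarrow> I \<notin> bases M \<Longrightarrow> B \<in> bases M \<Longrightarrow> \<exists>x\<in>B - I. insert x I \<in> indep M"
  using I3 by (simp add: bases_def)

lemma extend_maximal:
  assumes "I \<in> indep M" "I \<subseteq> X" "X \<subseteq> ground M"
  shows "\<exists>J\<in>indep M. I \<subseteq> J \<and> J \<subseteq> X \<and> (\<forall>x\<in>X - J. insert x J \<notin> indep M)"
proof -
  obtain J where J: "maximal_in {I'\<in>indep M. I \<subseteq> I' \<and> I' \<subseteq> X} J"
    using IM[OF assms] by blast
  have "insert x J \<notin> indep M" if "x \<in> X - J" for x
    using J that unfolding maximal_in_def by blast
  then show ?thesis using J unfolding maximal_in_def by blast
qed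

text \<open>If a maximal independent subset of \<open>X\<close> above \<open>I\<close> were not a
  basis, (I3) would enlarge it by an element of \<open>B\<close>, hence inside \<open>X\<close>. A
  basis can thus be steered into any set that already contains one.\<close>

lemma extend_basis_within:
  assumes "I \<in> indep M" "I \<subseteq> X" "X \<subseteq> ground M" "B \<in> bases M" "B \<subseteq> X"
  shows "\<exists>B'\<in>bases M. I \<subseteq> B' \<and> B' \<subseteq> X"
proof -
  obtain J where J: "J \<in> indep M" "I \<subseteq> J" "J \<subseteq> X" "\<forall>x\<in>X - J. insert x J \<notin> indep M"
    using extend_maximal[OF assms(1-3)] by blast
  have "J \<in> bases M"
    using augment[OF J(1) _ assms(4)] J(4) assms(5) by blast
  then show ?thesis using J by blast
qed

lemma basis_exists: obtains B where "B \<in> bases M"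
proof -
  obtain J where J: "J \<in> indep M" "\<forall>x\<in>ground M - J. insert x J \<notin> indep M"
    using extend_maximal[OF I1 empty_subsetI order_refl] by blast
  have "K = J" if K: "K \<in> indep M" "J \<subseteq> K" for K
  proof (rule ccontr)
    assume "K \<noteq> J"
    then obtain x where x: "x \<in> K" "x \<notin> J" using K by blast
    have "insert x J \<in> indep M" by (rule I2[OF K(1)]) (use K(2) x in blast)
    moreover have "x \<in> ground M - J" using x indep_subset_ground[OF K(1)] by blast
    ultimately show False using J(2) by blast
  qed
  then have "J \<in> bases M" using J(1) unfolding bases_def maximal_in_def by blast
  then show thesis by (rule that)
qed

lemma extend_basis:
  assumes "I \<in> indep M"
  obtains B where "B \<in> bases M" "I \<subseteq> B"
proof -
  obtain B0 where B0: "B0 \<in> bases M" by (rule basis_exists)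
  obtain B where "B \<in> bases M" "I \<subseteq> B" "B \<subseteq> ground M"
    using extend_basis_within[OF assms indep_subset_ground[OF assms] order_refl B0
        indep_subset_ground[OF basis_indep[OF B0]]] by blast
  then show thesis using that by simp
qed

lemma basis_remove_not_basis:
  assumes "B \<in> bases M" "z \<in> B"
  shows "B - {z} \<notin> bases M"
  using basis_maximal[of "B - {z}" B] basis_indep assms by blast

text \<open>For finite sets this is a matter of cardinality. Here \<open>B - {z}\<close> is no
  basis, and \<open>y\<close> is the only element of \<open>J\<close> that can augment it; the
  result contains \<open>J\<close> and so equals it.\<close>

lemma basis_swap:
  assumes B: "B \<in> bases M" and J: "J \<in> bases M" "J - B = {y}"
  obtains z where "z \<in> B" "z \<notin> J" "J = insert y (B - {z})"
proof -
  have "\<not> B \<subseteq> J" using basis_maximal[OF B basis_indep[OF J(1)]] J(2) by auto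
  then obtain z where z: "z \<in> B" "z \<notin> J" by blast
  have "B - {z} \<in> indep M" using I2[OF basis_indep[OF B]] by blast
  then obtain w where w: "w \<in> J - (B - {z})" "insert w (B - {z}) \<in> indep M"
    using augment basis_remove_not_basis[OF B z(1)] J(1) by blast
  have "w = y" using w z J(2) by blast
  moreover have "J \<subseteq> insert y (B - {z})" using z J(2) by blast
  ultimately have "J = insert y (B - {z})"
    using basis_maximal[OF J(1) w(2)] by simp
  then show thesis using that z by blast
qed

text \<open>The substance is (I3). Maximal independent subsets of \<open>X\<close> extend to bases
  of \<open>M\<close>, but augmentation in \<open>M\<close> might happen outside \<open>X\<close>.
  Confining a basis \<open>B\<close> above \<open>I\<close> to \<open>I \<union> B'\<close> controls
  this.\<close>

lemma matroid_deletion: "matroid (deletion M D)"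
proof -
  define X where "X = ground M - D"
  have XE: "X \<subseteq> ground M" by (auto simp: X_def)
  have iD: "indep (deletion M D) = {I \<in> indep M. I \<subseteq> X}"
    unfolding deletion_def X_def using indep_subset_ground by auto
  have gD: "ground (deletion M D) = X" by (simp add: deletion_def X_def)
  show ?thesis
  proof
    show "indep (deletion M D) \<subseteq> Pow (ground (deletion M D))" by (auto simp: iD gD)
    show "{} \<in> indep (deletion M D)" by (simp add: iD I1)
    show "J \<in> indep (deletion M D)" if "I \<in> indep (deletion M D)" "J \<subseteq> I" for I J
      using that I2 by (auto simp: iD)
    show "\<exists>J. maximal_in {I' \<in> indep (deletion M D). I \<subseteq> I' \<and> I' \<subseteq> Y} J"
      if "I \<in> indep (deletion M D)" "I \<subseteq> Y" "Y \<subseteq> ground (deletion M D)" for I Y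
    proof -
      have "{I' \<in> indep (deletion M D). I \<subseteq> I' \<and> I' \<subseteq> Y} = {I' \<in> indep M. I \<subseteq> I' \<and> I' \<subseteq> Y}"
        using that by (auto simp: iD gD)
      then show ?thesis using IM[of I Y] that XE by (auto simp: iD gD)
    qed
    fix I I'
    assume I: "I \<in> indep (deletion M D)" and nmax: "\<not> maximal_in (indep (deletion M D)) I"
      and max: "maximal_in (indep (deletion M D)) I'"
    have I_i: "I \<in> indep M" "I \<subseteq> X" using I by (auto simp: iD)
    have I'_i: "I' \<in> indep M" "I' \<subseteq> X" using max by (auto simp: iD maximal_in_def)
    have I'_max: "K = I'" if "K \<in> indep M" "K \<subseteq> X" "I' \<subseteq> K" for K
      using max that by (auto simp: iD maximal_in_def)
    obtain K where K: "K \<in> indep M" "K \<subseteq> X" "I \<subset> K"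
      using nmax I by (auto simp: iD maximal_in_def)
    then obtain y where y: "y \<in> X" "y \<notin> I" "insert y I \<in> indep M"
      using I2[OF K(1)] by (metis K(3) insert_subset psubset_imp_ex_mem DiffD1 DiffD2 psubset_eq subsetD)
    obtain B' where B': "B' \<in> bases M" "I' \<subseteq> B'" using extend_basis[OF I'_i(1)] .
    have B'X: "B' \<inter> X = I'"
      using I'_max[of "B' \<inter> X"] I2[OF basis_indep[OF B'(1)]] B' I'_i by blast
    have B'_g: "B' \<subseteq> ground M" using B' basis_indep indep_subset_ground by blast
    obtain B where B: "B \<in> bases M" "I \<subseteq> B" "B \<subseteq> I \<union> B'"
      using extend_basis_within[OF I_i(1), of "I \<union> B'" B'] indep_subset_ground[OF I_i(1)] B' B'_g
      by blast
    show "\<exists>x\<in>I' - I. insert x I \<in> indep (deletion M D)"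
    proof (cases "B \<inter> X = I")
      case False
      then obtain x where x: "x \<in> B" "x \<in> X" "x \<notin> I" using B I_i by blast
      then have "x \<in> I'" using B B'X by blast
      moreover have "insert x I \<in> indep M" using I2[OF basis_indep[OF B(1)]] x B by blast
      ultimately show ?thesis using x I_i by (auto simp: iD)
    next
      case True
      \<comment> \<open>Here \<open>B\<close> gains nothing inside \<open>X\<close>. Adding
        \<open>y\<close> pushes out some \<open>z\<close> outside \<open>X\<close>, which then lies
        in \<open>B'\<close>; augmenting \<open>B' - {z}\<close> from \<open>J\<close> is possible
        only with an element of \<open>X\<close>, against the maximality of
        \<open>I'\<close>.\<close>
      have B_g: "B \<subseteq> ground M" using B basis_indep indep_subset_ground by blast
      have yB: "y \<notin> B" using True y by blast
      obtain J where J: "J \<in> bases M" "insert y I \<subseteq> J" "J \<subseteq> insert y B"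
        using extend_basis_within[OF y(3), of "insert y B" B] B B_g y XE by blast
      have "J - B = {y}" using J yB by blast
      then obtain z where z: "z \<in> B" "z \<notin> J" "J = insert y (B - {z})"
        using basis_swap[OF B(1) J(1)] by blast
      have zX: "z \<notin> X" "z \<in> B'" using z True J B by blast+
      have "B' - {z} \<in> indep M" using I2[OF basis_indep[OF B'(1)]] by blast
      then obtain w where w: "w \<in> J - (B' - {z})" "insert w (B' - {z}) \<in> indep M"
        using augment basis_remove_not_basis[OF B'(1) zX(2)] J(1) by blast
      have wX: "w \<in> X" "w \<notin> B'"
        using w z J B I_i y by blast+
      have "insert w I' \<in> indep M"
        using I2[OF w(2)] B'(2) I'_i zX by blast
      then show ?thesis using I'_max[of "insert w I'"] wX I'_i B'(2) by blast
    qed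
  qed
qed

section \<open>Dual matroids\<close>

lemma ground_dual [simp]: "ground (dual M) = ground M"
  by (simp add: dual_def)

lemma indep_dual_iff: "I \<in> indep (dual M) \<longleftrightarrow> (\<exists>B\<in>bases M. I \<subseteq> ground M - B)"
  by (simp add: dual_def)

lemma bases_dual: "bases (dual M) = (\<lambda>B. ground M - B) ` bases M"
proof -
  have B_g: "B \<subseteq> ground M" if "B \<in> bases M" for B
    using that basis_indep indep_subset_ground by blast
  have "ground M - B \<in> bases (dual M)" if B: "B \<in> bases M" for B
  proof -
    have "Y = ground M - B" if Y: "Y \<in> indep (dual M)" "ground M - B \<subseteq> Y" for Y
    proof -
      obtain B2 where B2: "B2 \<in> bases M" "Y \<subseteq> ground M - B2"
        using Y(1) by (auto simp: indep_dual_iff)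
      then have "B2 \<subseteq> B" using Y(2) B_g by blast
      then have "B2 = B" using basis_maximal[OF B2(1) basis_indep[OF B]] by simp
      then show ?thesis using B2 Y by blast
    qed
    then show ?thesis
      using B by (auto simp: bases_def[of "dual M"] maximal_in_def indep_dual_iff)
  qed
  moreover have "X \<in> (\<lambda>B. ground M - B) ` bases M" if X: "X \<in> bases (dual M)" for X
  proof -
    obtain B where B: "B \<in> bases M" "X \<subseteq> ground M - B"
      using X by (auto simp: bases_def[of "dual M"] maximal_in_def indep_dual_iff)
    then have "ground M - B \<in> indep (dual M)" by (auto simp: indep_dual_iff)
    then have "ground M - B = X"
      using X B by (auto simp: bases_def[of "dual M"] maximal_in_def)
    then show ?thesis using B by blast
  qed
  ultimately show ?thesis by blast
qed

lemma matroid_dual: "matroid (dual M)"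
proof
  have B_g: "B \<subseteq> ground M" if "B \<in> bases M" for B
    using that basis_indep indep_subset_ground by blast
  show "indep (dual M) \<subseteq> Pow (ground (dual M))" by (auto simp: indep_dual_iff)
  show "{} \<in> indep (dual M)" using basis_exists by (auto simp: indep_dual_iff)
  show "J \<in> indep (dual M)" if "I \<in> indep (dual M)" "J \<subseteq> I" for I J
    using that by (auto simp: indep_dual_iff)
  show "\<exists>x\<in>I' - I. insert x I \<in> indep (dual M)"
    if I: "I \<in> indep (dual M)" and nmax: "\<not> maximal_in (indep (dual M)) I"
      and max: "maximal_in (indep (dual M)) I'" for I I'
  proof -
    have "I' \<in> bases (dual M)" using max by (simp add: bases_def)
    then obtain B where B: "B \<in> bases M" "I' = ground M - B" by (auto simp: bases_dual)
    obtain B0 where B0: "B0 \<in> bases M" "I \<subseteq> ground M - B0" using I by (auto simp: indep_dual_iff)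
    \<comment> \<open>The complement of \<open>B2\<close> contains \<open>I\<close> and lies in
      \<open>I \<union> I'\<close>, so any element it has beyond \<open>I\<close> will do.\<close>
    obtain B2 where B2: "B2 \<in> bases M" "B - I \<subseteq> B2" "B2 \<subseteq> ground M - I"
      using extend_basis_within[of "B - I" "ground M - I" B0] I2[OF basis_indep[OF B(1)]]
        B0 B_g[OF B(1)] B_g[OF B0(1)] by blast
    have "ground M - B2 \<noteq> I"
      using nmax B2 bases_dual by (auto simp: bases_def[of "dual M"])
    then obtain x where x: "x \<in> ground M" "x \<notin> B2" "x \<notin> I" using B2 B0 by blast
    then have "insert x I \<in> indep (dual M)" using B2 B0 by (auto simp: indep_dual_iff)
    then show ?thesis using x B B2 by blast
  qed
  show "\<exists>J. maximal_in {I' \<in> indep (dual M). I \<subseteq> I' \<and> I' \<subseteq> X} J"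
    if I: "I \<in> indep (dual M)" and IX: "I \<subseteq> X" and X: "X \<subseteq> ground (dual M)" for I X
  proof -
    obtain B0 where B0: "B0 \<in> bases M" "I \<subseteq> ground M - B0" using I by (auto simp: indep_dual_iff)
    \<comment> \<open>A basis that is as large as possible outside \<open>X\<close> has a minimal
      trace on \<open>X\<close>, so its complement is maximal there. If \<open>K\<close> were
      larger, dropping an element of \<open>K\<close> from \<open>B1\<close> could be repaired only
      outside \<open>X\<close>, where \<open>J\<close> is already maximal.\<close>
    obtain J where J: "J \<in> indep M" "J \<subseteq> ground M - X"
      "\<forall>x\<in>ground M - X - J. insert x J \<notin> indep M"
      using extend_maximal[OF I1, of "ground M - X"] by blast
    obtain B1 where B1: "B1 \<in> bases M" "J \<subseteq> B1" "B1 \<subseteq> ground M - I"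
      using extend_basis_within[OF J(1), of "ground M - I" B0] J(2) IX B0 B_g by blast
    have "maximal_in {I' \<in> indep (dual M). I \<subseteq> I' \<and> I' \<subseteq> X} (X - B1)"
      unfolding maximal_in_def
    proof (intro conjI ballI impI CollectI)
      show "X - B1 \<in> indep (dual M)" using B1 X by (auto simp: indep_dual_iff)
      show "I \<subseteq> X - B1" using IX B1 by blast
      show "X - B1 \<subseteq> X" by blast
      fix K assume "K \<in> {I' \<in> indep (dual M). I \<subseteq> I' \<and> I' \<subseteq> X}" and XK: "X - B1 \<subseteq> K"
      then obtain B3 where K: "K \<subseteq> X" and B3: "B3 \<in> bases M" "K \<subseteq> ground M - B3"
        by (auto simp: indep_dual_iff)
      show "K = X - B1"
      proof (rule ccontr)
        assume "K \<noteq> X - B1"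
        then obtain z where z: "z \<in> K" "z \<in> B1" using K XK by blast
        have "B1 - {z} \<in> indep M" using I2[OF basis_indep[OF B1(1)]] by blast
        then obtain w where w: "w \<in> B3 - (B1 - {z})" "insert w (B1 - {z}) \<in> indep M"
          using augment basis_remove_not_basis[OF B1(1) z(2)] B3(1) by blast
        have wB: "w \<notin> B1" "w \<notin> X" using w z B3 XK by blast+
        have "insert w J \<in> indep M" using I2[OF w(2)] B1(2) J(2) z K by blast
        then show False using J(3) wB w B3 B_g B1(2) by blast
      qed
    qed
    then show ?thesis by blast
  qed
qed

lemma dual_dual: "dual (dual M) = M"
proof -
  interpret D: matroid "dual M" by (rule matroid_dual)
  have "I \<in> indep (dual (dual M)) \<longleftrightarrow> I \<in> indep M" for I
  proof
    assume "I \<in> indep (dual (dual M))"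
    then show "I \<in> indep M"
      using I2[OF basis_indep] by (auto simp: D.indep_dual_iff bases_dual)
  next
    assume "I \<in> indep M"
    then obtain B where "B \<in> bases M" "I \<subseteq> B" by (rule extend_basis)
    moreover from this have "B \<subseteq> ground M" using basis_indep indep_subset_ground by blast
    ultimately show "I \<in> indep (dual (dual M))"
      by (auto simp: D.indep_dual_iff bases_dual)
  qed
  then show ?thesis by (intro set_system.equality) (auto simp: D.ground_dual)
qed

section \<open>Circuits, cocircuits and their intersections\<close>

lemma circuit_iff:
  "C \<in> circuits M \<longleftrightarrow> C \<subseteq> ground M \<and> C \<notin> indep M \<and> (\<forall>x\<in>C. C - {x} \<in> indep M)"
proof
  assume C: "C \<in> circuits M"
  then have g: "C \<subseteq> ground M" "C \<notin> indep M" by (simp_all add: circuits_def minimal_in_def)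
  have "C - {x} \<in> indep M" if "x \<in> C" for x
  proof (rule ccontr)
    assume "C - {x} \<notin> indep M"
    moreover have "C - {x} \<subseteq> ground M" using g by blast
    ultimately have "C - {x} = C" using C unfolding circuits_def minimal_in_def by blast
    then show False using that by blast
  qed
  then show "C \<subseteq> ground M \<and> C \<notin> indep M \<and> (\<forall>x\<in>C. C - {x} \<in> indep M)" using g by blast
next
  assume C: "C \<subseteq> ground M \<and> C \<notin> indep M \<and> (\<forall>x\<in>C. C - {x} \<in> indep M)"
  have "Y = C" if Y: "Y \<notin> indep M" "Y \<subseteq> C" for Y
  proof (rule ccontr)
    assume "Y \<noteq> C"
    then obtain x where x: "x \<in> C" "x \<notin> Y" using Y by blast
    have "Y \<in> indep M" by (rule I2[of "C - {x}"]) (use C x Y in auto)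
    then show False using Y by blast
  qed
  then show "C \<in> circuits M" using C unfolding circuits_def minimal_in_def by blast
qed

lemma circuit_subset_ground: "C \<in> circuits M \<Longrightarrow> C \<subseteq> ground M"
  and circuit_dependent: "C \<in> circuits M \<Longrightarrow> C \<notin> indep M"
  and circuit_remove_indep: "C \<in> circuits M \<Longrightarrow> x \<in> C \<Longrightarrow> C - {x} \<in> indep M"
  by (auto simp: circuit_iff)

lemma circuit_nonempty: "C \<in> circuits M \<Longrightarrow> C \<noteq> {}"
  using circuit_dependent I1 by auto

lemma circuit_subset_eq:
  "C \<in> circuits M \<Longrightarrow> C' \<in> circuits M \<Longrightarrow> C' \<subseteq> C \<Longrightarrow> C' = C"
  by (auto simp: circuits_def minimal_in_def)

lemma dependent_contains_circuit:
  assumes X: "X \<subseteq> ground M" "X \<notin> indep M"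
  obtains C where "C \<in> circuits M" "C \<subseteq> X"
proof -
  obtain J where J: "J \<in> indep M" "J \<subseteq> X" "\<forall>x\<in>X - J. insert x J \<notin> indep M"
    using extend_maximal[OF I1 _ X(1)] by blast
  have "J \<noteq> X" using J X by blast
  then obtain y where y: "y \<in> X" "y \<notin> J" using J by blast
  define C where "C = {z \<in> insert y J. insert y J - {z} \<in> indep M}"
  have yJ: "insert y J \<notin> indep M" using J(3) y by blast
  have Jg: "insert y J \<subseteq> ground M" using J(2) y X by blast
  have yC: "y \<in> C" using J(1) y by (simp add: C_def)
  let ?N = "deletion M (ground M - insert y J)"
  interpret N: matroid ?N by (rule matroid_deletion)
  have iN: "indep ?N = {I \<in> indep M. I \<subseteq> insert y J}"
    using indep_subset_ground by (auto simp: deletion_def)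
  have gN: "ground ?N = insert y J" using Jg by (auto simp: deletion_def)
  have "C \<notin> indep M"
  proof
    assume C: "C \<in> indep M"
    have "Y = J" if "Y \<in> indep M" "Y \<subseteq> insert y J" "J \<subseteq> Y" for Y
    proof -
      have "Y \<noteq> insert y J" using yJ that by blast
      then show ?thesis using that by blast
    qed
    then have Jb: "J \<in> bases ?N"
      using J(1) unfolding bases_def maximal_in_def iN by blast
    \<comment> \<open>\<open>K\<close> will turn out to be \<open>insert y J - {z}\<close> for some
      \<open>z\<close> in \<open>J\<close>. Then \<open>z\<close> belongs to \<open>C\<close> by the
      definition of \<open>C\<close>, although \<open>K\<close> contains \<open>C\<close>.\<close>
    obtain K where K: "K \<in> bases ?N" "C \<subseteq> K"
      using N.extend_basis[of C] C by (auto simp: iN C_def)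
    then have "K \<subseteq> insert y J" using N.basis_indep by (auto simp: iN)
    then have "K - J = {y}" using K yC y by blast
    then obtain z where z: "z \<in> J" "z \<notin> K" "K = insert y (J - {z})"
      using N.basis_swap[OF Jb K(1)] by blast
    then have "K = insert y J - {z}" using y by blast
    then have "z \<in> C" using N.basis_indep[OF K(1)] z by (simp add: C_def iN)
    then show False using K z by blast
  qed
  moreover have "C - {z} \<in> indep M" if "z \<in> C" for z
    using that I2[of "insert y J - {z}" "C - {z}"] by (auto simp: C_def)
  ultimately have "C \<in> circuits M" using Jg by (auto simp: circuit_iff C_def)
  moreover have "C \<subseteq> X" using J(2) y by (auto simp: C_def)
  ultimately show thesis by (rule that)
qed

lemma fundamental_circuit:
  assumes J: "J \<in> indep M" and x: "x \<in> ground M" "insert x J \<notin> indep M"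
  shows "\<exists>C\<in>circuits M. C \<subseteq> insert x J \<and> x \<in> C"
proof -
  have "insert x J \<subseteq> ground M" using x(1) indep_subset_ground[OF J] by blast
  then obtain C where C: "C \<in> circuits M" "C \<subseteq> insert x J"
    using dependent_contains_circuit x(2) by blast
  then have "x \<in> C" using I2[OF J] circuit_dependent by blast
  then show ?thesis using C by blast
qed

text \<open>If they met only in \<open>e\<close>, then \<open>C - {e}\<close> would extend to a
  basis avoiding \<open>D - {e}\<close>. That basis must contain \<open>e\<close>, for otherwise
  \<open>D\<close> would be coindependent, and so it contains all of \<open>C\<close>.\<close>

lemma circuit_Int_cocircuit_not_singleton:
  assumes C: "C \<in> circuits M" and D: "D \<in> cocircuits M"
  shows "C \<inter> D \<noteq> {e}"
proof
  assume eq: "C \<inter> D = {e}"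
  interpret D: matroid "dual M" by (rule matroid_dual)
  have D': "D \<in> circuits (dual M)" using D by (simp add: cocircuits_def)
  have "D - {e} \<in> indep (dual M)" using D.circuit_remove_indep[OF D'] eq by blast
  then obtain B where B: "B \<in> bases M" "D - {e} \<subseteq> ground M - B" by (auto simp: indep_dual_iff)
  have B_g: "B \<subseteq> ground M" using B basis_indep indep_subset_ground by blast
  have "C - {e} \<in> indep M" using circuit_remove_indep[OF C] eq by blast
  then obtain B2 where B2: "B2 \<in> bases M" "C - {e} \<subseteq> B2" "B2 \<subseteq> ground M - (D - {e})"
    using extend_basis_within[of "C - {e}" "ground M - (D - {e})" B] B B_g eq
      circuit_subset_ground[OF C] by blast
  have "e \<in> B2"
  proof (rule ccontr)
    assume "e \<notin> B2"
    then have "D \<subseteq> ground M - B2" using B2 D.circuit_subset_ground[OF D'] by auto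
    then have "D \<in> indep (dual M)" using B2 by (auto simp: indep_dual_iff)
    then show False using D.circuit_dependent[OF D'] by blast
  qed
  then have "C \<subseteq> B2" using B2 by blast
  then show False using I2[OF basis_indep[OF B2(1)]] circuit_dependent[OF C] by blast
qed

text \<open>The fundamental cocircuit of \<open>e\<close> with respect to a basis containing
  \<open>I\<close>.\<close>

lemma cocircuit_meets_indep_once:
  assumes I: "I \<in> indep M" "e \<in> I"
  obtains D where "D \<in> cocircuits M" "D \<inter> I = {e}"
proof -
  interpret D: matroid "dual M" by (rule matroid_dual)
  obtain B where B: "B \<in> bases M" "I \<subseteq> B" using extend_basis[OF I(1)] .
  have B_g: "B \<subseteq> ground M" using B basis_indep indep_subset_ground by blast
  have cB: "ground M - B \<in> bases (dual M)" using B by (auto simp: bases_dual)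
  have "insert e (ground M - B) \<notin> indep (dual M)"
    using D.basis_maximal[OF cB, of "insert e (ground M - B)"] I B by blast
  then obtain D where D: "D \<in> circuits (dual M)" "D \<subseteq> insert e (ground M - B)"
    using D.dependent_contains_circuit[of "insert e (ground M - B)"] I B B_g by auto
  have "e \<in> D"
    using D D.I2[OF D.basis_indep[OF cB]] D.circuit_dependent by blast
  then have "D \<inter> I = {e}" using D I B by blast
  then show thesis using that D by (simp add: cocircuits_def)
qed

text \<open>Minty's painting lemma: the elements of \<open>X - {e}\<close> have one colour, those outside \<open>X\<close> the
  other.\<close>

lemma circuit_or_cocircuit:
  assumes X: "X \<subseteq> ground M" and e: "e \<in> X"
  shows "(\<exists>C\<in>circuits M. e \<in> C \<and> C \<subseteq> X) \<or> (\<exists>D\<in>cocircuits M. D \<inter> X = {e})"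
proof (rule disjCI)
  assume no_cocircuit: "\<not> (\<exists>D\<in>cocircuits M. D \<inter> X = {e})"
  show "\<exists>C\<in>circuits M. e \<in> C \<and> C \<subseteq> X"
  proof (rule ccontr)
    assume no_circuit: "\<not> ?thesis"
    obtain J where J: "J \<in> indep M" "J \<subseteq> X - {e}"
      "\<forall>x\<in>X - {e} - J. insert x J \<notin> indep M"
      using extend_maximal[OF I1, of "X - {e}"] X by blast
    have circ: "\<exists>C\<in>circuits M. C \<subseteq> insert x J \<and> x \<in> C" if "x \<in> X" "insert x J \<notin> indep M" for x
      using fundamental_circuit[OF J(1)] X that by blast
    \<comment> \<open>If no circuit through \<open>e\<close> lies in \<open>X\<close>, then
      \<open>e\<close> can be added to \<open>J\<close>. A cocircuit meeting
      \<open>insert e J\<close> only in \<open>e\<close> cannot meet \<open>X\<close> elsewhere,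
      because every other element of \<open>X\<close> outside \<open>J\<close> closes a circuit over
      \<open>J\<close>.\<close>
    have eJ: "insert e J \<in> indep M" using circ[of e] no_circuit J(2) e by blast
    then obtain D where D: "D \<in> cocircuits M" "D \<inter> insert e J = {e}"
      using cocircuit_meets_indep_once[of "insert e J" e] by blast
    have "y = e" if y: "y \<in> D" "y \<in> X" for y
    proof (rule ccontr)
      assume "y \<noteq> e"
      then have "y \<notin> J" using y D by blast
      then obtain C where C: "C \<in> circuits M" "C \<subseteq> insert y J" "y \<in> C"
        using circ[of y] J(3) y \<open>y \<noteq> e\<close> by blast
      have "e \<notin> J" using J(2) by blast
      then have "x \<notin> D" if "x \<in> J" for x
        using that D(2) by (metis IntI insertCI singletonD)
      then have "C \<inter> D = {y}" using C(2,3) y(1) by blast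
      then show False using circuit_Int_cocircuit_not_singleton[OF C(1) D(1)] by blast
    qed
    then have "D \<inter> X = {e}" using D(2) e by blast
    then show False using D(1) no_cocircuit by blast
  qed
qed

lemma cocircuits_dual: "cocircuits (dual M) = circuits M"
  by (simp add: cocircuits_def dual_dual)

lemma cocircuit_subset_ground: "D \<in> cocircuits M \<Longrightarrow> D \<subseteq> ground M"
  using matroid.circuit_subset_ground[OF matroid_dual] by (simp add: cocircuits_def)

text \<open>The painting lemma for the complement of \<open>D\<close> together with \<open>e\<close>
  and \<open>f\<close>: a cocircuit meeting this set only in \<open>e\<close> would be contained in
  \<open>D\<close> and miss \<open>f\<close>.\<close>

lemma circuit_meets_cocircuit_twice:
  assumes D: "D \<in> cocircuits M" and e: "e \<in> D" and f: "f \<in> D" and "e \<noteq> f"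
  obtains C where "C \<in> circuits M" "C \<inter> D = {e, f}"
proof -
  let ?X = "insert e (insert f (ground M - D))"
  have X: "?X \<subseteq> ground M" using cocircuit_subset_ground[OF D] e f by blast
  have "D' \<inter> ?X \<noteq> {e}" if D': "D' \<in> cocircuits M" for D'
  proof
    assume eq: "D' \<inter> ?X = {e}"
    have "f \<notin> D'" using eq \<open>e \<noteq> f\<close> by auto
    moreover have "D' \<subseteq> D" using eq e cocircuit_subset_ground[OF D'] by auto
    ultimately show False
      using matroid.circuit_subset_eq[OF matroid_dual] D D' f unfolding cocircuits_def by blast
  qed
  then have "\<exists>C\<in>circuits M. e \<in> C \<and> C \<subseteq> ?X"
    using circuit_or_cocircuit[OF X, of e] by blast
  then obtain C where C: "C \<in> circuits M" "e \<in> C" "C \<subseteq> ?X" by blast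
  then have "C \<inter> D = {e, f}"
    using circuit_Int_cocircuit_not_singleton[OF C(1) D, of e] e by blast
  then show thesis using that C by blast
qed

lemma cocircuit_meets_circuit_twice:
  assumes "C \<in> circuits M" "e \<in> C" "f \<in> C" "e \<noteq> f"
  obtains D where "D \<in> cocircuits M" "D \<inter> C = {e, f}"
proof -
  have "C \<in> cocircuits (dual M)" using assms(1) by (simp add: cocircuits_dual)
  from matroid.circuit_meets_cocircuit_twice[OF matroid_dual this assms(2-4)]
  show thesis using that unfolding cocircuits_def by blast
qed

lemma tame_finite_ground:
  assumes "finite (ground M)"
  shows "tame M"
  unfolding tame_def
proof (intro ballI)
  fix C D assume "C \<in> circuits M"
  then have "C \<inter> D \<subseteq> ground M" using circuit_subset_ground by blast
  then show "finite (C \<inter> D)" using assms by (rule finite_subset)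
qed

end

section \<open>Circuits and cocircuits of minors\<close>

lemma circuits_deletion: "circuits (deletion M A) = {C \<in> circuits M. C \<inter> A = {}}"
proof -
  have "{X. X \<subseteq> ground (deletion M A) \<and> X \<notin> indep (deletion M A)} =
      {X. X \<subseteq> ground M \<and> X \<notin> indep M} \<inter> {X. X \<inter> A = {}}" (is "?F = ?G \<inter> _")
    by (auto simp: deletion_def)
  moreover have "minimal_in (?G \<inter> {X. X \<inter> A = {}}) C \<longleftrightarrow> minimal_in ?G C \<and> C \<inter> A = {}" for C
    unfolding minimal_in_def by blast
  ultimately show ?thesis unfolding circuits_def by (metis (mono_tags, lifting) Collect_cong mem_Collect_eq)
qed

lemma ground_deletion [simp]: "ground (deletion M A) = ground M - A"
  by (simp add: deletion_def)

lemma ground_contraction [simp]: "ground (contraction M A) = ground M - A"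
  by (simp add: contraction_def dual_def)

context matroid
begin

lemma matroid_contraction: "matroid (contraction M A)"
  unfolding contraction_def by (intro matroid.matroid_dual matroid.matroid_deletion matroid_axioms)

lemma dual_contraction: "dual (contraction M A) = deletion (dual M) A"
  unfolding contraction_def by (intro matroid.dual_dual matroid.matroid_deletion matroid_dual)

lemma dual_deletion: "dual (deletion M A) = contraction (dual M) A"
  unfolding contraction_def by (simp add: dual_dual)

lemma cocircuits_contraction: "cocircuits (contraction M A) = {D \<in> cocircuits M. D \<inter> A = {}}"
  by (simp add: cocircuits_def dual_contraction circuits_deletion)

text \<open>Cocircuits of the contraction are the cocircuits of \<open>M\<close> avoiding
  \<open>A\<close>, and they meet \<open>C - A\<close> exactly where they meet \<open>C\<close>, so
  never in one element. The painting lemma inside the contraction then gives the circuit.\<close>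

lemma contraction_circuit_below:
  assumes C: "C \<in> circuits M" and x: "x \<in> C - A"
  obtains C' where "C' \<in> circuits (contraction M A)" "x \<in> C'" "C' \<subseteq> C - A"
proof -
  interpret N: matroid "contraction M A" by (rule matroid_contraction)
  have X: "C - A \<subseteq> ground (contraction M A)" using circuit_subset_ground[OF C] by auto
  have "D \<inter> (C - A) \<noteq> {x}" if "D \<in> cocircuits (contraction M A)" for D
  proof -
    have "D \<in> cocircuits M" "D \<inter> (C - A) = C \<inter> D" using that by (auto simp: cocircuits_contraction)
    then show ?thesis using circuit_Int_cocircuit_not_singleton[OF C] by simp
  qed
  then show thesis using N.circuit_or_cocircuit[OF X x] that by blast
qed

text \<open>The painting lemma in \<open>M\<close>, applied to \<open>C' \<union> A\<close>. The
  circuit found contains, outside \<open>A\<close>, a circuit of the contraction within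
  \<open>C'\<close>, and circuits are not properly nested.\<close>

lemma contraction_circuit_lift:
  assumes A: "A \<subseteq> ground M" and C': "C' \<in> circuits (contraction M A)"
  obtains C where "C \<in> circuits M" "C - A = C'"
proof -
  interpret N: matroid "contraction M A" by (rule matroid_contraction)
  obtain x where x: "x \<in> C'" using N.circuit_nonempty[OF C'] by blast
  have g: "C' \<subseteq> ground M - A" using N.circuit_subset_ground[OF C'] by simp
  have X: "C' \<union> A \<subseteq> ground M" "x \<in> C' \<union> A" using g A x by blast+
  have "D \<inter> (C' \<union> A) \<noteq> {x}" if D: "D \<in> cocircuits M" for D
  proof
    assume eq: "D \<inter> (C' \<union> A) = {x}"
    have "x \<notin> A" using x g by blast
    then have "D \<inter> A = {}" using eq by auto
    then have "D \<in> cocircuits (contraction M A)" "C' \<inter> D = {x}"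
      using eq D by (auto simp: cocircuits_contraction)
    then show False using N.circuit_Int_cocircuit_not_singleton[OF C'] by blast
  qed
  then have "\<exists>C\<in>circuits M. x \<in> C \<and> C \<subseteq> C' \<union> A"
    using circuit_or_cocircuit[OF X] by blast
  then obtain C where C: "C \<in> circuits M" "x \<in> C" "C \<subseteq> C' \<union> A" by blast
  then obtain C'' where C'': "C'' \<in> circuits (contraction M A)" "C'' \<subseteq> C - A"
    using contraction_circuit_below[of C x A] x g by blast
  then have "C'' = C'" using N.circuit_subset_eq[OF C', of C''] C by blast
  then show thesis using that[of C] C C'' by blast
qed

end

locale matroid_minor = matroid +
  fixes A B
  assumes A: "A \<subseteq> ground M" and B: "B \<subseteq> ground M" and AB: "A \<inter> B = {}"
begin

abbreviation "N \<equiv> deletion (contraction M A) B"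

lemma is_minor_N: "is_minor N M"
  unfolding is_minor_def using A B AB by blast

lemma matroid_N: "matroid N"
  by (intro matroid.matroid_deletion matroid_contraction)

lemma minor_circuit_lift:
  assumes "C' \<in> circuits N"
  obtains C where "C \<in> circuits M" "C' \<subseteq> C" "C \<subseteq> C' \<union> A"
  using contraction_circuit_lift[OF A, of C'] assms by (auto simp: circuits_deletion)

text \<open>Deletion is contraction in the dual; hence the facts about cocircuits of the minor are
  instances of those about circuits of a contraction.\<close>

lemma cocircuits_N: "cocircuits N = circuits (contraction (dual (contraction M A)) B)"
  by (simp add: cocircuits_def matroid.dual_deletion[OF matroid_contraction])

lemma minor_cocircuit_lift:
  assumes "D' \<in> cocircuits N"
  obtains D where "D \<in> cocircuits M" "D' \<subseteq> D" "D \<subseteq> D' \<union> B"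
proof -
  interpret K: matroid "contraction M A" by (rule matroid_contraction)
  have "B \<subseteq> ground (dual (contraction M A))" using B AB by auto
  moreover have "D' \<in> circuits (contraction (dual (contraction M A)) B)"
    using assms by (simp only: cocircuits_N)
  ultimately obtain D where "D \<in> circuits (dual (contraction M A))" "D - B = D'"
    using matroid.contraction_circuit_lift[OF K.matroid_dual] by blast
  moreover from this have "D \<in> cocircuits M"
    using cocircuits_contraction by (auto simp: cocircuits_def)
  ultimately show thesis using that by blast
qed

lemma minor_circuit_below:
  assumes "C \<in> circuits M" "C \<inter> B = {}" "x \<in> C - A"
  obtains C' where "C' \<in> circuits N" "x \<in> C'" "C' \<subseteq> C - A"
proof -
  obtain C' where "C' \<in> circuits (contraction M A)" "x \<in> C'" "C' \<subseteq> C - A"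
    using contraction_circuit_below assms by blast
  then show thesis using that[of C'] assms by (auto simp: circuits_deletion)
qed

lemma minor_cocircuit_below:
  assumes "D \<in> cocircuits M" "D \<inter> A = {}" "x \<in> D - B"
  obtains D' where "D' \<in> cocircuits N" "x \<in> D'" "D' \<subseteq> D - B"
proof -
  interpret K: matroid "contraction M A" by (rule matroid_contraction)
  have "D \<in> circuits (dual (contraction M A))"
    using assms cocircuits_contraction by (auto simp: cocircuits_def)
  then obtain D' where "D' \<in> circuits (contraction (dual (contraction M A)) B)" "x \<in> D'" "D' \<subseteq> D - B"
    using matroid.contraction_circuit_below[OF K.matroid_dual, of D x B] assms by blast
  then show thesis using that by (simp add: cocircuits_N)
qed

end

lemma is_minorE:
  assumes "matroid M" "is_minor N M"
  obtains A B where "matroid_minor M A B" "N = deletion (contraction M A) B"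
proof -
  from assms(2) obtain A B where "A \<subseteq> ground M" "B \<subseteq> ground M" "A \<inter> B = {}"
    and N: "N = deletion (contraction M A) B"
    unfolding is_minor_def by (elim exE conjE) (rule that)
  then have "matroid_minor M A B"
    using assms(1) by (simp add: matroid_minor_def matroid_minor_axioms_def)
  then show thesis using N by (rule that)
qed

section \<open>Signings and compactness\<close>

text \<open>Divisibility by 0 means being 0, so \<open>q = 0\<close> is signability proper, while
  \<open>q = 2\<close> and \<open>q = 3\<close> are what a field with \<open>q\<close> elements
  supplies. Inheritance by minors is thus proved once for all three.\<close>

definition signable_mod :: "int \<Rightarrow> 'e set_system \<Rightarrow> bool" where
  "signable_mod q M \<longleftrightarrow> (\<exists>c d.
     (\<forall>C\<in>circuits M. \<forall>e\<in>C. c C e \<in> {1, -1}) \<and>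
     (\<forall>D\<in>cocircuits M. \<forall>e\<in>D. d D e \<in> {1, -1}) \<and>
     (\<forall>C\<in>circuits M. \<forall>D\<in>cocircuits M.
        finite (C \<inter> D) \<and> q dvd (\<Sum>e\<in>C \<inter> D. c C e * d D e)))"

lemma signable_iff_mod_0: "signable M \<longleftrightarrow> signable_mod 0 M"
  by (simp add: signable_def signing_def signable_mod_def)

lemma signable_modE:
  assumes "signable_mod q M"
  obtains c d where "\<forall>C\<in>circuits M. \<forall>e\<in>C. c C e \<in> {1, -1}"
    and "\<forall>D\<in>cocircuits M. \<forall>e\<in>D. d D e \<in> {1, -1}"
    and "\<forall>C\<in>circuits M. \<forall>D\<in>cocircuits M.
      finite (C \<inter> D) \<and> q dvd (\<Sum>e\<in>C \<inter> D. c C e * d D e)"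
  using assms unfolding signable_mod_def by (elim exE conjE) (rule that)

text \<open>A lifted circuit grows only by elements of \<open>A\<close>, a lifted cocircuit only by
  elements of \<open>B\<close>; these are disjoint from each other and from the ground set of the
  minor. The lifts intersect in the same set, so their signs can be copied.\<close>

lemma (in matroid_minor) signable_mod_minor:
  assumes "signable_mod q M"
  shows "signable_mod q N"
proof -
  obtain c d :: "'a set \<Rightarrow> 'a \<Rightarrow> int" where c: "\<forall>C\<in>circuits M. \<forall>e\<in>C. c C e \<in> {1, -1}"
    and d: "\<forall>D\<in>cocircuits M. \<forall>e\<in>D. d D e \<in> {1, -1}"
    and orth: "\<forall>C\<in>circuits M. \<forall>D\<in>cocircuits M.
      finite (C \<inter> D) \<and> q dvd (\<Sum>e\<in>C \<inter> D. c C e * d D e)"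
    using assms by (rule signable_modE)
  have "\<exists>C. C \<in> circuits M \<and> C' \<subseteq> C \<and> C \<subseteq> C' \<union> A" if "C' \<in> circuits N" for C'
    by (rule minor_circuit_lift[OF that]) blast
  then obtain up where up: "\<And>C'. C' \<in> circuits N \<Longrightarrow> up C' \<in> circuits M \<and> C' \<subseteq> up C' \<and> up C' \<subseteq> C' \<union> A"
    by metis
  have "\<exists>D. D \<in> cocircuits M \<and> D' \<subseteq> D \<and> D \<subseteq> D' \<union> B" if "D' \<in> cocircuits N" for D'
    by (rule minor_cocircuit_lift[OF that]) blast
  then obtain coup where coup: "\<And>D'. D' \<in> cocircuits N \<Longrightarrow>
      coup D' \<in> cocircuits M \<and> D' \<subseteq> coup D' \<and> coup D' \<subseteq> D' \<union> B"
    by metis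
  have eq: "up C' \<inter> coup D' = C' \<inter> D'" if "C' \<in> circuits N" "D' \<in> cocircuits N" for C' D'
  proof -
    have "C' \<subseteq> ground M - A - B" "D' \<subseteq> ground M - A - B"
      using matroid.circuit_subset_ground[OF matroid_N that(1)]
        matroid.cocircuit_subset_ground[OF matroid_N that(2)] by simp_all
    then show ?thesis using up[OF that(1)] coup[OF that(2)] AB by blast
  qed
  show ?thesis
    unfolding signable_mod_def
  proof (intro exI conjI ballI)
    fix C' D' assume CD: "C' \<in> circuits N" "D' \<in> cocircuits N"
    have "finite (up C' \<inter> coup D') \<and> q dvd (\<Sum>e\<in>up C' \<inter> coup D'. c (up C') e * d (coup D') e)"
      using orth up[OF CD(1)] coup[OF CD(2)] by blast
    then show "finite (C' \<inter> D')" "q dvd (\<Sum>e\<in>C' \<inter> D'. c (up C') e * d (coup D') e)"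
      by (simp_all add: eq[OF CD])
  next
    fix C' e assume "C' \<in> circuits N" "e \<in> C'"
    then show "c (up C') e \<in> {1, -1}" using c up[of C'] by blast
  next
    fix D' e assume "D' \<in> cocircuits N" "e \<in> D'"
    then show "d (coup D') e \<in> {1, -1}" using d coup[of D'] by blast
  qed
qed

text \<open>Compactness of \<open>V\<close> to the power \<open>'i\<close>, phrased for nets indexed by finite sets.\<close>

lemma finite_net_cluster_point:
  fixes l :: "'j set \<Rightarrow> 'i \<Rightarrow> 'v"
  assumes V: "finite V" and l: "\<And>F i. finite F \<Longrightarrow> l F i \<in> V"
  shows "\<exists>m. \<forall>F G. finite F \<longrightarrow> finite G \<longrightarrow> (\<exists>F'. finite F' \<and> F \<subseteq> F' \<and> (\<forall>i\<in>G. l F' i = m i))"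
proof -
  define X where "X = product_topology (\<lambda>i::'i. discrete_topology V) UNIV"
  have top: "topspace X = {x. \<forall>i. x i \<in> V}" by (auto simp: X_def PiE_def Pi_def)
  have "compact_space X"
    unfolding X_def by (simp add: compact_space_product_topology compact_space_discrete_topology V)
  \<comment> \<open>The tails of the net. Their closures have the finite intersection property,
    witnessed by \<open>l\<close> at the union of the index sets; a common point of all closures is
    the cluster point.\<close>
  define T where "T F = {l F' |F'. finite F' \<and> F \<subseteq> F'}" for F
  have T: "T F \<subseteq> topspace X" for F using l by (auto simp: T_def top)
  have ne: "\<Inter> \<F> \<noteq> {}" if \<F>: "finite \<F>" "\<F> \<subseteq> (\<lambda>F. X closure_of T F) ` {F. finite F}" for \<F>
  proof -
    obtain \<G> where \<G>: "\<G> \<subseteq> {F. finite F}" "finite \<G>" "\<F> = (\<lambda>F. X closure_of T F) ` \<G>"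
      using finite_subset_image[OF \<F>] by blast
    have "l (\<Union>\<G>) \<in> X closure_of T F" if "F \<in> \<G>" for F
    proof -
      have "finite (\<Union>\<G>)" "F \<subseteq> \<Union>\<G>" using \<G> that by auto
      then have "l (\<Union>\<G>) \<in> T F" unfolding T_def by blast
      then show ?thesis using closure_of_subset[OF T[of F]] by blast
    qed
    then show ?thesis using \<G>(3) by blast
  qed
  have "\<Inter> ((\<lambda>F. X closure_of T F) ` {F. finite F}) \<noteq> {}"
    by (rule \<open>compact_space X\<close>[unfolded compact_space_fip, rule_format])
      (use ne in auto)
  then obtain m where m: "\<And>F. finite F \<Longrightarrow> m \<in> X closure_of T F" by blast
  have mV: "m i \<in> V" for i
    using m[of "{}"] closure_of_subset_topspace[of X "T {}"] by (auto simp: top)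
  have "\<exists>F'. finite F' \<and> F \<subseteq> F' \<and> (\<forall>i\<in>G. l F' i = m i)" if FG: "finite F" "finite G" for F G
  proof -
    \<comment> \<open>The basic neighbourhood of \<open>m\<close> that fixes the coordinates in
      \<open>G\<close>.\<close>
    define U where "U = PiE UNIV (\<lambda>i. if i \<in> G then {m i} else V)"
    have "finite {i. (if i \<in> G then {m i} else V) \<noteq> V}"
      by (rule finite_subset[OF _ FG(2)]) auto
    then have "openin X U"
      unfolding U_def X_def openin_PiE_gen using mV by auto
    moreover have "m \<in> U" using mV by (auto simp: U_def)
    ultimately obtain y where y: "y \<in> T F" "y \<in> U"
      using m[OF FG(1)] unfolding in_closure_of by blast
    then obtain F' where F': "finite F'" "F \<subseteq> F'" "y = l F'" by (auto simp: T_def)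
    have "l F' i = m i" if "i \<in> G" for i
      using y(2) that F'(3) by (auto simp: U_def PiE_def Pi_def split: if_splits)
    then show ?thesis using F' by blast
  qed
  then show ?thesis by blast
qed

text \<open>Contracting a part of a circuit \<open>C\<close> may split another circuit \<open>C'\<close>. The cocircuits
  meeting \<open>C'\<close> exactly in two given elements prevent this, as long as they are not destroyed.\<close>

lemma (in matroid) finite_minor_with_intersections:
  assumes tame: "tame M" and \<C>: "finite \<C>" "\<C> \<subseteq> circuits M" and \<D>: "finite \<D>" "\<D> \<subseteq> cocircuits M"
    and F_def: "F = (\<Union>C\<in>\<C>. \<Union>D\<in>\<D>. C \<inter> D)"
  shows "\<exists>A B. matroid_minor M A B \<and> finite (ground (deletion (contraction M A) B)) \<and>
    (\<forall>C\<in>\<C>. C \<inter> F \<noteq> {} \<longrightarrow> (\<exists>C'\<in>circuits (deletion (contraction M A) B). C' \<subseteq> C \<and> C' \<inter> F = C \<inter> F)) \<and>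
    (\<forall>D\<in>\<D>. D \<inter> F \<noteq> {} \<longrightarrow> (\<exists>D'\<in>cocircuits (deletion (contraction M A) B). D' \<subseteq> D \<and> D' \<inter> F = D \<inter> F))"
proof -
  have fin: "finite (C \<inter> D)" if "C \<in> circuits M" "D \<in> cocircuits M" for C D
    using tame that by (auto simp: tame_def)
  have finF: "finite F" unfolding F_def using \<C> \<D> fin by blast
  \<comment> \<open>Each triple names two elements of \<open>F\<close> that must not be separated
    when \<open>X\<close> is cut down in the minor. It receives a guard: a cocircuit or circuit
    meeting \<open>X\<close> in exactly these two elements.\<close>
  define P where "P \<X> = {(X, e, f). X \<in> \<X> \<and> e \<in> X \<inter> F \<and> f \<in> X \<inter> F \<and> e \<noteq> f}" for \<X>
  have finP: "finite (P \<X>)" if "finite \<X>" for \<X>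
    by (rule finite_subset[of _ "\<X> \<times> F \<times> F"]) (use that finF in \<open>auto simp: P_def\<close>)
  have "\<exists>Y. Y \<in> cocircuits M \<and> Y \<inter> fst p = {fst (snd p), snd (snd p)}" if "p \<in> P \<C>" for p
  proof -
    obtain X e f where p: "p = (X, e, f)" by (metis prod_cases3)
    have "X \<in> circuits M" "e \<in> X" "f \<in> X" "e \<noteq> f" using that \<C>(2) by (auto simp: p P_def)
    then show ?thesis unfolding p fst_conv snd_conv by (rule cocircuit_meets_circuit_twice) blast
  qed
  then obtain \<beta> where \<beta>: "\<And>p. p \<in> P \<C> \<Longrightarrow> \<beta> p \<in> cocircuits M \<and> \<beta> p \<inter> fst p = {fst (snd p), snd (snd p)}"
    by metis
  have "\<exists>Y. Y \<in> circuits M \<and> Y \<inter> fst p = {fst (snd p), snd (snd p)}" if "p \<in> P \<D>" for p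
  proof -
    obtain X e f where p: "p = (X, e, f)" by (metis prod_cases3)
    have "X \<in> cocircuits M" "e \<in> X" "f \<in> X" "e \<noteq> f" using that \<D>(2) by (auto simp: p P_def)
    then show ?thesis unfolding p fst_conv snd_conv by (rule circuit_meets_cocircuit_twice) blast
  qed
  then obtain \<gamma> where \<gamma>: "\<And>p. p \<in> P \<D> \<Longrightarrow> \<gamma> p \<in> circuits M \<and> \<gamma> p \<inter> fst p = {fst (snd p), snd (snd p)}"
    by metis
  define \<C>' where "\<C>' = \<C> \<union> \<gamma> ` P \<D>"
  define \<D>' where "\<D>' = \<D> \<union> \<beta> ` P \<C>"
  have \<C>': "finite \<C>'" "\<C>' \<subseteq> circuits M" using \<C> finP[OF \<D>(1)] \<gamma> by (auto simp: \<C>'_def)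
  have \<D>': "finite \<D>'" "\<D>' \<subseteq> cocircuits M" using \<D> finP[OF \<C>(1)] \<beta> by (auto simp: \<D>'_def)
  define F1 where "F1 = (\<Union>C\<in>\<C>'. \<Union>D\<in>\<D>'. C \<inter> D)"
  have finF1: "finite F1" unfolding F1_def using \<C>' \<D>' fin by blast
  have FF1: "F \<subseteq> F1" unfolding F_def F1_def \<C>'_def \<D>'_def by blast
  \<comment> \<open>Elements outside \<open>F1\<close> are contracted if some listed circuit uses
    them and deleted otherwise. So no listed circuit meets the deleted set, no listed cocircuit
    meets the contracted set, and what remains is finite.\<close>
  define A where "A = \<Union>\<C>' - F1"
  define B where "B = ground M - F1 - A"
  have Ag: "A \<subseteq> ground M" unfolding A_def using \<C>'(2) circuit_subset_ground by blast
  interpret minor: matroid_minor M A B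
    by unfold_locales (use Ag in \<open>auto simp: B_def\<close>)
  interpret N: matroid minor.N by (rule minor.matroid_N)
  have CB: "C \<inter> B = {}" if "C \<in> \<C>'" for C using that by (auto simp: B_def A_def)
  have DA: "D \<inter> A = {}" if "D \<in> \<D>'" for D using that by (auto simp: A_def F1_def)
  have FA: "F \<inter> A = {}" "F \<inter> B = {}" using FF1 by (auto simp: A_def B_def)
  have below: "\<exists>C'\<in>circuits minor.N. x \<in> C' \<and> C' \<subseteq> C" if C: "C \<in> \<C>'" "x \<in> C" "x \<in> F" for C x
  proof -
    have "C \<in> circuits M" "x \<in> C - A" using C \<C>'(2) FA by blast+
    then obtain C' where "C' \<in> circuits minor.N" "x \<in> C'" "C' \<subseteq> C - A"
      using minor.minor_circuit_below[OF _ CB[OF C(1)]] by metis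
    then show ?thesis by blast
  qed
  have cobelow: "\<exists>D'\<in>cocircuits minor.N. x \<in> D' \<and> D' \<subseteq> D" if D: "D \<in> \<D>'" "x \<in> D" "x \<in> F" for D x
  proof -
    have "D \<in> cocircuits M" "x \<in> D - B" using D \<D>'(2) FA by blast+
    then obtain D' where "D' \<in> cocircuits minor.N" "x \<in> D'" "D' \<subseteq> D - B"
      using minor.minor_cocircuit_below[OF _ DA[OF D(1)]] by metis
    then show ?thesis by blast
  qed
  have circ: "\<exists>C'\<in>circuits minor.N. C' \<subseteq> C \<and> C' \<inter> F = C \<inter> F" if C: "C \<in> \<C>" "C \<inter> F \<noteq> {}" for C
  proof -
    obtain e where e: "e \<in> C" "e \<in> F" using C by blast
    obtain C' where C': "C' \<in> circuits minor.N" "e \<in> C'" "C' \<subseteq> C"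
      using below[of C e] C e by (auto simp: \<C>'_def)
    have "f \<in> C'" if f: "f \<in> C" "f \<in> F" for f
    proof (rule ccontr)
      assume fC': "f \<notin> C'"
      then have p: "(C, e, f) \<in> P \<C>" using C e f C' by (auto simp: P_def)
      \<comment> \<open>The guard at work: \<open>C'\<close> lies in \<open>C\<close> and misses
        \<open>f\<close>, so a cocircuit of the minor through \<open>e\<close> inside
        \<open>?D\<close> meets \<open>C'\<close> only in \<open>e\<close>.\<close>
      let ?D = "\<beta> (C, e, f)"
      have D: "?D \<in> \<D>'" "?D \<inter> C = {e, f}" using \<beta>[OF p] p by (auto simp: \<D>'_def)
      then obtain D' where D': "D' \<in> cocircuits minor.N" "e \<in> D'" "D' \<subseteq> ?D"
        using cobelow[of ?D e] e by blast
      have "C' \<inter> D' \<subseteq> {e, f}" using D(2) C'(3) D'(3) by blast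
      then have "C' \<inter> D' = {e}" using C'(2) D'(2) fC' by blast
      then show False using N.circuit_Int_cocircuit_not_singleton[OF C'(1) D'(1)] by blast
    qed
    then show ?thesis using C' by blast
  qed
  have cocirc: "\<exists>D'\<in>cocircuits minor.N. D' \<subseteq> D \<and> D' \<inter> F = D \<inter> F" if D: "D \<in> \<D>" "D \<inter> F \<noteq> {}" for D
  proof -
    obtain e where e: "e \<in> D" "e \<in> F" using D by blast
    obtain D' where D': "D' \<in> cocircuits minor.N" "e \<in> D'" "D' \<subseteq> D"
      using cobelow[of D e] D e by (auto simp: \<D>'_def)
    have "f \<in> D'" if f: "f \<in> D" "f \<in> F" for f
    proof (rule ccontr)
      assume fD': "f \<notin> D'"
      then have p: "(D, e, f) \<in> P \<D>" using D e f D' by (auto simp: P_def)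
      let ?C = "\<gamma> (D, e, f)"
      have C: "?C \<in> \<C>'" "?C \<inter> D = {e, f}" using \<gamma>[OF p] p by (auto simp: \<C>'_def)
      then obtain C' where C': "C' \<in> circuits minor.N" "e \<in> C'" "C' \<subseteq> ?C"
        using below[of ?C e] e by blast
      have "C' \<inter> D' \<subseteq> {e, f}" using C(2) C'(3) D'(3) by blast
      then have "C' \<inter> D' = {e}" using C'(2) D'(2) fD' by blast
      then show False using N.circuit_Int_cocircuit_not_singleton[OF C'(1) D'(1)] by blast
    qed
    then show ?thesis using D' by blast
  qed
  have finN: "finite (ground minor.N)"
    by (rule finite_subset[OF _ finF1]) (auto simp: B_def)
  show ?thesis
    by (intro exI[of _ A] exI[of _ B])
      (use minor.matroid_minor_axioms finN circ cocirc in simp)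
qed

text \<open>The net is indexed by finite sets \<open>P\<close> of pairs of a circuit and a
  cocircuit. By tameness the equation for one pair involves finitely many signs, so it survives at a
  cluster point.\<close>

lemma (in matroid) signable_if_finite_minors_signable:
  assumes tame: "tame M"
    and minors: "\<And>N. is_minor N M \<Longrightarrow> finite (ground N) \<Longrightarrow> signable N"
  shows "signable M"
proof -
  have fin: "finite (C \<inter> D)" if "C \<in> circuits M" "D \<in> cocircuits M" for C D
    using tame that by (auto simp: tame_def)
  define good :: "('e set \<times> 'e set) set \<Rightarrow> (bool \<times> 'e set \<times> 'e \<Rightarrow> int) \<Rightarrow> bool" where
    "good P s \<longleftrightarrow> range s \<subseteq> {1, -1} \<and> (\<forall>C\<in>circuits M. \<forall>D\<in>cocircuits M. (C, D) \<in> P \<longrightarrow>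
      (\<Sum>e\<in>C \<inter> D. s (True, C, e) * s (False, D, e)) = 0)" for P s
  have "\<exists>s. good P s"
    if P: "finite P" for P :: "('e set \<times> 'e set) set"
  proof -
    define \<C> where "\<C> = fst ` P \<inter> circuits M"
    define \<D> where "\<D> = snd ` P \<inter> cocircuits M"
    define F where "F = (\<Union>C\<in>\<C>. \<Union>D\<in>\<D>. C \<inter> D)"
    have "finite \<C>" "\<C> \<subseteq> circuits M" "finite \<D>" "\<D> \<subseteq> cocircuits M" using P by (auto simp: \<C>_def \<D>_def)
    from finite_minor_with_intersections[OF tame this F_def] obtain A B where
      AB: "matroid_minor M A B" and finN: "finite (ground (deletion (contraction M A) B))" and
      C: "\<forall>C\<in>\<C>. C \<inter> F \<noteq> {} \<longrightarrow>
        (\<exists>C'\<in>circuits (deletion (contraction M A) B). C' \<subseteq> C \<and> C' \<inter> F = C \<inter> F)" and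
      D: "\<forall>D\<in>\<D>. D \<inter> F \<noteq> {} \<longrightarrow>
        (\<exists>D'\<in>cocircuits (deletion (contraction M A) B). D' \<subseteq> D \<and> D' \<inter> F = D \<inter> F)"
      by (elim exE conjE) (rule that)
    interpret minor: matroid_minor M A B by (rule AB)
    have "signable_mod 0 minor.N"
      using minors[OF minor.is_minor_N finN] by (simp add: signable_iff_mod_0)
    then obtain c d :: "'e set \<Rightarrow> 'e \<Rightarrow> int" where c: "\<forall>C\<in>circuits minor.N. \<forall>e\<in>C. c C e \<in> {1, -1}"
      and d: "\<forall>D\<in>cocircuits minor.N. \<forall>e\<in>D. d D e \<in> {1, -1}"
      and orth: "\<forall>C\<in>circuits minor.N. \<forall>D\<in>cocircuits minor.N.
        finite (C \<inter> D) \<and> 0 dvd (\<Sum>e\<in>C \<inter> D. c C e * d D e)"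
      by (rule signable_modE)
    obtain \<pi> where \<pi>: "\<And>C. C \<in> \<C> \<Longrightarrow> C \<inter> F \<noteq> {} \<Longrightarrow> \<pi> C \<in> circuits minor.N \<and> \<pi> C \<subseteq> C \<and> \<pi> C \<inter> F = C \<inter> F"
      using C by metis
    obtain \<rho> where \<rho>: "\<And>D. D \<in> \<D> \<Longrightarrow> D \<inter> F \<noteq> {} \<Longrightarrow> \<rho> D \<in> cocircuits minor.N \<and> \<rho> D \<subseteq> D \<and> \<rho> D \<inter> F = D \<inter> F"
      using D by metis
    \<comment> \<open>Values are forced into \<open>{1, -1}\<close> even at irrelevant arguments,
      which keeps the whole net in a finite set; at relevant arguments nothing changes.\<close>
    define s :: "bool \<times> 'e set \<times> 'e \<Rightarrow> int" where
      "s = (\<lambda>(b, X, e). if (if b then c (\<pi> X) e else d (\<rho> X) e) = 1 then 1 else - 1)"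
    have "(\<Sum>e\<in>C \<inter> D. s (True, C, e) * s (False, D, e)) = 0"
      if CD: "C \<in> circuits M" "D \<in> cocircuits M" "(C, D) \<in> P" for C D
    proof (cases "C \<inter> D = {}")
      case False
      have in_CD: "C \<in> \<C>" "D \<in> \<D>" using CD by (force simp: \<C>_def \<D>_def)+
      then have sub: "C \<inter> D \<subseteq> F" by (auto simp: F_def)
      then have "C \<inter> F \<noteq> {}" "D \<inter> F \<noteq> {}" using False by blast+
      note \<pi>C = \<pi>[OF in_CD(1) this(1)] and \<rho>D = \<rho>[OF in_CD(2) this(2)]
      have eq: "\<pi> C \<inter> \<rho> D = C \<inter> D" using \<pi>C \<rho>D sub by blast
      have "(\<Sum>e\<in>C \<inter> D. s (True, C, e) * s (False, D, e)) = (\<Sum>e\<in>\<pi> C \<inter> \<rho> D. c (\<pi> C) e * d (\<rho> D) e)"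
        unfolding eq
      proof (rule sum.cong[OF refl])
        fix e assume "e \<in> C \<inter> D"
        then have "e \<in> \<pi> C" "e \<in> \<rho> D" unfolding eq[symmetric] by blast+
        then have "c (\<pi> C) e \<in> {1, -1}" "d (\<rho> D) e \<in> {1, -1}"
          using c[rule_format, of "\<pi> C" e] d[rule_format, of "\<rho> D" e] \<pi>C \<rho>D by simp_all
        then show "s (True, C, e) * s (False, D, e) = c (\<pi> C) e * d (\<rho> D) e" by (auto simp: s_def)
      qed
      also have "\<dots> = 0" using orth \<pi>C \<rho>D by simp
      finally show ?thesis .
    qed simp
    moreover have "range s \<subseteq> {1, -1}" by (auto simp: s_def)
    ultimately have "good P s" by (simp add: good_def)
    then show ?thesis by blast
  qed
  then obtain s where s: "\<And>P. finite P \<Longrightarrow> good P (s P)" by metis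
  have sV: "s P i \<in> {1, -1}" if "finite P" for P i using s[OF that] by (auto simp: good_def)
  have "\<exists>m. \<forall>P G. finite P \<longrightarrow> finite G \<longrightarrow> (\<exists>P'. finite P' \<and> P \<subseteq> P' \<and> (\<forall>i\<in>G. s P' i = m i))"
    by (rule finite_net_cluster_point[of "{1, -1}"]) (simp, rule sV)
  then obtain m where
    m: "\<forall>P G. finite P \<longrightarrow> finite G \<longrightarrow> (\<exists>P'. finite P' \<and> P \<subseteq> P' \<and> (\<forall>i\<in>G. s P' i = m i))"
    by (elim exE) (rule that)
  note m = m[THEN spec, THEN spec, THEN mp, THEN mp]
  have mV: "m i \<in> {1, -1}" for i
  proof -
    obtain P' where "finite P'" "s P' i = m i" using m[of "{}" "{i}"] by auto
    then show ?thesis using sV[of P' i] by simp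
  qed
  have "(\<Sum>e\<in>C \<inter> D. m (True, C, e) * m (False, D, e)) = 0"
    if CD: "C \<in> circuits M" "D \<in> cocircuits M" for C D
  proof -
    let ?G = "(\<lambda>e. (True, C, e)) ` (C \<inter> D) \<union> (\<lambda>e. (False, D, e)) ` (C \<inter> D)"
    obtain P' where P': "finite P'" "{(C, D)} \<subseteq> P'" "\<forall>i\<in>?G. s P' i = m i"
      using m[of "{(C, D)}" ?G] fin[OF CD] by auto
    have "(\<Sum>e\<in>C \<inter> D. m (True, C, e) * m (False, D, e)) =
        (\<Sum>e\<in>C \<inter> D. s P' (True, C, e) * s P' (False, D, e))"
      using P'(3) by (intro sum.cong) auto
    then show ?thesis using s[OF P'(1)] CD P'(2) by (simp add: good_def)
  qed
  then have "signing M (\<lambda>C e. m (True, C, e)) (\<lambda>D e. m (False, D, e))"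
    unfolding signing_def by (intro conjI ballI mV fin)
  then show ?thesis unfolding signable_def by blast
qed

section \<open>Signings of finite matroids modulo two and three\<close>

text \<open>Every product of two signs is odd, so modulo 2 the orthogonality sum counts the
  intersection.\<close>

lemma (in matroid) even_card_Int_if_signable_mod_2:
  assumes s: "signable_mod 2 M" and C: "C \<in> circuits M" and D: "D \<in> cocircuits M"
  shows "finite (C \<inter> D) \<and> even (card (C \<inter> D))"
proof -
  obtain c d :: "'e set \<Rightarrow> 'e \<Rightarrow> int" where c: "\<forall>C\<in>circuits M. \<forall>e\<in>C. c C e \<in> {1, -1}"
    and d: "\<forall>D\<in>cocircuits M. \<forall>e\<in>D. d D e \<in> {1, -1}"
    and orth: "\<forall>C\<in>circuits M. \<forall>D\<in>cocircuits M.
      finite (C \<inter> D) \<and> 2 dvd (\<Sum>e\<in>C \<inter> D. c C e * d D e)"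
    using s by (rule signable_modE)
  have fin: "finite (C \<inter> D)" and ev: "even (\<Sum>e\<in>C \<inter> D. c C e * d D e)" using orth C D by blast+
  have "odd (c C e * d D e)" if "e \<in> C \<inter> D" for e
    using c[rule_format, OF C, of e] d[rule_format, OF D, of e] that by auto
  then have "{e \<in> C \<inter> D. odd (c C e * d D e)} = C \<inter> D" by blast
  then show ?thesis using even_sum_iff[OF fin, of "\<lambda>e. c C e * d D e"] ev fin by simp
qed

text \<open>By parity a cocircuit meets the symmetric difference in an even number of elements,
  hence never in \<open>e\<close> alone; the painting lemma leaves only a circuit.\<close>

lemma (in matroid) circuit_in_sym_diff:
  assumes s: "signable_mod 2 M" and C1: "C1 \<in> circuits M" and C2: "C2 \<in> circuits M" and e: "e \<in> sym_diff C1 C2"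
  shows "\<exists>C\<in>circuits M. e \<in> C \<and> C \<subseteq> sym_diff C1 C2"
proof -
  have "D \<inter> sym_diff C1 C2 \<noteq> {e}" if D: "D \<in> cocircuits M" for D
  proof -
    note even = even_card_Int_if_signable_mod_2[OF s _ D]
    let ?I = "C1 \<inter> C2 \<inter> D" and ?X = "(C1 - C2) \<inter> D" and ?Y = "(C2 - C1) \<inter> D"
    have fin: "finite (C1 \<inter> D)" "finite (C2 \<inter> D)" using even C1 C2 by blast+
    have finX: "finite ?I" "finite ?X" "finite ?Y" 
      by (rule finite_subset[OF _ fin(1)], blast, rule finite_subset[OF _ fin(1)], blast,
          rule finite_subset[OF _ fin(2)], blast)
    have "C1 \<inter> D = ?I \<union> ?X" by blast
    then have "card (C1 \<inter> D) = card ?I + card ?X"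
      using card_Un_disjoint[OF finX(1,2)] by (metis Diff_disjoint Int_Diff inf_assoc inf_commute inf_left_commute inf_bot_right)
    moreover have "C2 \<inter> D = ?I \<union> ?Y" by blast
    then have "card (C2 \<inter> D) = card ?I + card ?Y"
      using card_Un_disjoint[OF finX(1,3)] by (metis Diff_disjoint Int_Diff inf_assoc inf_commute inf_left_commute inf_bot_right)
    moreover have "D \<inter> sym_diff C1 C2 = ?X \<union> ?Y" by blast
    then have "card (D \<inter> sym_diff C1 C2) = card ?X + card ?Y"
      using card_Un_disjoint[OF finX(2,3)] by auto
    moreover have "even (card (C1 \<inter> D))" "even (card (C2 \<inter> D))" using even C1 C2 by blast+
    ultimately have "even (card (D \<inter> sym_diff C1 C2))" by presburger
    then show ?thesis by auto
  qed
  moreover have "sym_diff C1 C2 \<subseteq> ground M"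
    using circuit_subset_ground[OF C1] circuit_subset_ground[OF C2] by blast
  ultimately show ?thesis using circuit_or_cocircuit[OF _ e] by blast
qed

text \<open>A ternary signing of a binary matroid is a signing over the integers: \<open>C\<close> is split along a
  circuit \<open>C1\<close> for which \<open>C\<close>, \<open>C1\<close> is a modular pair, so that the vector of \<open>C\<close> is a signed sum of
  the vectors of two circuits which meet \<open>D\<close> in proper subsets of \<open>C \<inter> D\<close>.\<close>

lemma (in matroid) signable_if_signable_mod_2_3:
  assumes fin: "finite (ground M)" and s2: "signable_mod 2 M" and s3: "signable_mod 3 M"
  shows "signable M"
proof -
  let ?E = "ground M"
  obtain c d :: "'e set \<Rightarrow> 'e \<Rightarrow> int" where c: "\<forall>C\<in>circuits M. \<forall>e\<in>C. c C e \<in> {1, -1}"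
    and d: "\<forall>D\<in>cocircuits M. \<forall>e\<in>D. d D e \<in> {1, -1}"
    and orth: "\<forall>C\<in>circuits M. \<forall>D\<in>cocircuits M.
      finite (C \<inter> D) \<and> 3 dvd (\<Sum>e\<in>C \<inter> D. c C e * d D e)"
    using s3 by (rule signable_modE)
  note sym_diff = circuit_in_sym_diff[OF s2]
  define u where "u C x = (if x \<in> C then c C x else 0)" for C x
  define v where "v D x = (if x \<in> D then d D x else 0)" for D x
  define S where "S C D = (\<Sum>x\<in>?E. u C x * v D x)" for C D
  have u: "u C x = 1 \<or> u C x = -1" if "C \<in> circuits M" "x \<in> C" for C x
    using c that by (auto simp: u_def)
  have u0: "u C x = 0" if "x \<notin> C" for C x using that by (simp add: u_def)
  have S_eq: "S C D = (\<Sum>x\<in>C \<inter> D. c C x * d D x)" if C: "C \<in> circuits M" and D: "D \<in> cocircuits M" for C D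
    unfolding S_def using circuit_subset_ground[OF C] fin
    by (intro sum.mono_neutral_cong_right) (auto simp: u_def v_def)
  have S3: "3 dvd S C D" if "C \<in> circuits M" "D \<in> cocircuits M" for C D
    using orth that by (simp add: S_eq)
  \<comment> \<open>A vector orthogonal modulo 3 to all cocircuits has a support modulo 3 that is a
    union of circuits: a cocircuit meeting the support once would leave a single nonzero
    term.\<close>
  have support: "\<exists>C\<in>circuits M. y \<in> C \<and> (\<forall>x\<in>C. \<not> 3 dvd w x)"
    if w: "\<And>D. D \<in> cocircuits M \<Longrightarrow> 3 dvd (\<Sum>x\<in>?E. w x * v D x)" and y: "y \<in> ?E" "\<not> 3 dvd w y"
    for w y
  proof -
    let ?X = "{x \<in> ?E. \<not> 3 dvd w x}"
    have "D \<inter> ?X \<noteq> {y}" if D: "D \<in> cocircuits M" for D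
    proof
      assume eq: "D \<inter> ?X = {y}"
      have "(\<Sum>x\<in>?E. w x * v D x) = w y * v D y + (\<Sum>x\<in>?E - {y}. w x * v D x)"
        using fin y(1) by (simp add: sum.remove)
      moreover have "3 dvd (\<Sum>x\<in>?E - {y}. w x * v D x)"
      proof (rule dvd_sum)
        fix x assume x: "x \<in> ?E - {y}"
        show "3 dvd w x * v D x"
        proof (cases "x \<in> D")
          case True
          then have "3 dvd w x" using eq x by blast
          then show ?thesis by simp
        qed (simp add: v_def)
      qed
      ultimately have "3 dvd w y * v D y" using w[OF D] by (metis dvd_add_left_iff)
      moreover have "v D y = 1 \<or> v D y = -1" using d D eq by (auto simp: v_def)
      ultimately show False using y(2) by auto
    qed
    then have "\<exists>C\<in>circuits M. y \<in> C \<and> C \<subseteq> ?X"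
      using circuit_or_cocircuit[of ?X y] y by blast
    then show ?thesis by blast
  qed
  have S0: "S C D = 0" if D: "D \<in> cocircuits M" and C: "C \<in> circuits M" for C D
    using C
  proof (induction "card (C \<inter> D)" arbitrary: C rule: less_induct)
    case less
    note C = less.prems
    have finCD: "finite (C \<inter> D)" using orth C D by blast
    show ?case
    proof (cases "card (C \<inter> D) \<ge> 3")
      case False
      \<comment> \<open>With at most two signs the sum has absolute value below 3, and divisibility
        by 3 leaves only 0.\<close>
      have "\<bar>S C D\<bar> \<le> (\<Sum>x\<in>C \<inter> D. \<bar>c C x * d D x\<bar>)"
        unfolding S_eq[OF C D] by (rule sum_abs)
      also have "\<dots> = (\<Sum>x\<in>C \<inter> D. 1)"
      proof (rule sum.cong[OF refl])
        fix x assume "x \<in> C \<inter> D"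
        then have "c C x \<in> {1, -1}" "d D x \<in> {1, -1}" using c d C D by simp_all
        then show "\<bar>c C x * d D x\<bar> = 1" by auto
      qed
      finally have "\<bar>S C D\<bar> \<le> 2" using False by simp
      then show ?thesis using S3[OF C D] by presburger
    next
      case True
      then obtain T where "T \<subseteq> C \<inter> D" "card T = 3"
        using obtain_subset_with_card_n by metis
      then obtain e0 f0 g0 where efg: "e0 \<in> C \<inter> D" "f0 \<in> C \<inter> D" "g0 \<in> C \<inter> D"
        "e0 \<noteq> f0" "g0 \<noteq> e0" "g0 \<noteq> f0"
        unfolding card_3_iff by blast
      \<comment> \<open>\<open>Q\<close> is inhabited because a circuit can meet \<open>D\<close> in
        exactly two of the three elements at hand. Choosing \<open>C1\<close> in \<open>Q\<close>
        with the fewest elements outside \<open>C\<close> is what produces the modular pair.\<close>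
      define Q where "Q X \<longleftrightarrow> X \<in> circuits M \<and> X \<inter> D \<noteq> {} \<and> X \<inter> D \<subset> C \<inter> D" for X
      have "\<exists>X. Q X"
      proof -
        have ef: "e0 \<in> D" "f0 \<in> D" using efg by blast+
        obtain X where X: "X \<in> circuits M" "X \<inter> D = {e0, f0}"
          by (rule circuit_meets_cocircuit_twice[OF D ef efg(4)])
        have "{e0, f0} \<noteq> {}" "{e0, f0} \<subseteq> C \<inter> D" "g0 \<notin> {e0, f0}" using efg by simp_all
        then have "Q X" using X(1) efg(3) unfolding Q_def X(2) by blast
        then show ?thesis ..
      qed
      then obtain C1 where Q1: "Q C1" and least: "\<And>X. Q X \<Longrightarrow> card (C1 - C) \<le> card (X - C)"
        using ex_has_least_nat[of Q _ "\<lambda>X. card (X - C)"] by blast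
      have C1: "C1 \<in> circuits M" using Q1 by (simp add: Q_def)
      have C1D: "C1 \<inter> D \<subseteq> C" using Q1 unfolding Q_def by blast
      obtain e where e: "e \<in> C1" "e \<in> D" using Q1 unfolding Q_def by blast
      then have eC: "e \<in> C" using C1D by blast
      obtain g where g: "g \<in> C" "g \<in> D" "g \<notin> C1" using Q1 unfolding Q_def by blast
      obtain C2 where C2: "C2 \<in> circuits M" "g \<in> C2" "C2 \<subseteq> sym_diff C C1"
        using sym_diff[OF C C1, of g] g by blast
      have eC2: "e \<notin> C2" using C2(3) e eC by blast
      \<comment> \<open>The coefficients are chosen so that \<open>w\<close> vanishes at
        \<open>e\<close> and at \<open>g\<close>, signs being their own inverses.\<close>
      define t where "t = u C e * u C1 e"
      define s where "s = u C g * u C2 g"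
      define w where "w x = u C x - t * u C1 x - s * u C2 x" for x
      have t: "t = 1 \<or> t = -1" using u[OF C eC] u[OF C1 e(1)] by (auto simp: t_def)
      have s: "s = 1 \<or> s = -1" using u[OF C g(1)] u[OF C2(1,2)] by (auto simp: s_def)
      have we: "w e = 0" using u[OF C1 e(1)] u0[OF eC2] by (auto simp: w_def t_def)
      have wg: "w g = 0" using u[OF C2(1,2)] u0[OF g(3)] by (auto simp: w_def s_def)
      have w_out: "w x = 0" if "x \<notin> C \<union> C1" for x
      proof -
        have "x \<notin> C2" using that C2(3) by blast
        then show ?thesis using that by (simp add: w_def u0)
      qed
      have w_orth: "3 dvd (\<Sum>x\<in>?E. w x * v D' x)" if D': "D' \<in> cocircuits M" for D'
      proof -
        have "(\<Sum>x\<in>?E. w x * v D' x) = S C D' - t * S C1 D' - s * S C2 D'"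
          by (simp add: w_def S_def algebra_simps sum_subtractf sum.distrib sum_distrib_left)
        then show ?thesis using S3[OF C D'] S3[OF C1 D'] S3[OF C2(1) D'] by simp
      qed
      have finE: "finite (X - C)" if "X \<in> circuits M" for X
        using finite_subset[OF circuit_subset_ground[OF that] fin] by simp
      \<comment> \<open>A circuit \<open>C3\<close> in the support of \<open>w\<close> modulo 3
        avoids \<open>e\<close> and \<open>g\<close>. If it meets \<open>D\<close>, then by the
        choice of \<open>C1\<close> it agrees with \<open>C1\<close> outside \<open>C\<close>, which
        makes \<open>C4\<close> equal to \<open>C\<close> although \<open>C4\<close> misses
        \<open>g\<close>. If not, \<open>C4\<close> has fewer elements outside \<open>C\<close> than
        \<open>C1\<close>.\<close>
      have w0: "3 dvd w y" for y
      proof (rule ccontr)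
        assume y: "\<not> 3 dvd w y"
        then have "y \<in> C \<union> C1" using w_out by fastforce
        then have "y \<in> ?E" using circuit_subset_ground C C1 by blast
        then obtain C3 where C3: "C3 \<in> circuits M" "\<forall>x\<in>C3. \<not> 3 dvd w x"
          using support[OF w_orth _ y] by blast
        have "x \<in> C \<union> C1" if "x \<in> C3" for x
        proof (rule ccontr)
          assume "x \<notin> C \<union> C1"
          then have "w x = 0" by (rule w_out)
          then show False using C3(2) that by auto
        qed
        then have C3s: "C3 \<subseteq> C \<union> C1" by blast
        have eg: "e \<notin> C3" "g \<notin> C3" using C3(2) we wg by force+
        have C3C: "\<not> C3 \<subseteq> C" using circuit_subset_eq[OF C C3(1)] eg g by blast
        obtain C4 where C4: "C4 \<in> circuits M" "e \<in> C4" "C4 \<subseteq> sym_diff C1 C3"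
          using sym_diff[OF C1 C3(1), of e] e eg by blast
        show False
        proof (cases "C3 \<inter> D = {}")
          case False
          have "C3 \<inter> D \<subset> C \<inter> D" using C3s C1D g eg by blast
          then have "Q C3" using C3(1) False by (simp add: Q_def)
          then have "card (C1 - C) \<le> card (C3 - C)" by (rule least)
          moreover have "C3 - C \<subseteq> C1 - C" using C3s by blast
          ultimately have "C3 - C = C1 - C" using card_seteq finE[OF C1] by blast
          then have "C4 \<subseteq> C" using C4(3) by blast
          then have "C4 = C" using circuit_subset_eq[OF C C4(1)] by blast
          then show False using C4(3) g eg by blast
        next
          case True
          have "C4 \<inter> D \<subseteq> C1 \<inter> D" using True C4(3) by blast
          then have "C4 \<inter> D \<subset> C \<inter> D" using C1D g by blast
          then have "Q C4" using C4(1,2) e by (auto simp: Q_def)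
          then have "card (C1 - C) \<le> card (C4 - C)" by (rule least)
          moreover have "C4 - C \<subset> C1 - C" using C4(3) C3s C3C by blast
          ultimately show False using psubset_card_mono[OF finE[OF C1]] by (meson not_le)
        qed
      qed
      have "u C x * v D x = t * (u C1 x * v D x) + s * (u C2 x * v D x)" for x
      proof (cases "x \<in> D")
        case True
        \<comment> \<open>Within \<open>D\<close>, the circuits \<open>C1\<close> and
          \<open>C2\<close> stay inside \<open>C\<close> and are disjoint, so at most two of the
          three terms of \<open>w\<close> are nonzero. The multiple of 3 so obtained has absolute
          value at most 2.\<close>
        have "w x = 0"
        proof -
          have "\<bar>w x\<bar> \<le> 2"
          proof (cases "x \<in> C")
            case False
            then have "x \<notin> C1" "x \<notin> C2" using True C1D C2(3) by blast+
            then show ?thesis using False by (simp add: w_def u0)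
          next
            case xC: True
            show ?thesis
            proof (cases "x \<in> C1")
              case True
              then have "x \<notin> C2" using xC C2(3) by blast
              then show ?thesis using u[OF C xC] u[OF C1 True] t by (auto simp: w_def u0)
            next
              case False
              have "\<bar>u C2 x\<bar> \<le> 1" using u[OF C2(1), of x] u0[of x C2] by fastforce
              then show ?thesis using u[OF C xC] False s by (auto simp: w_def u0)
            qed
          qed
          then show ?thesis using w0[of x] by presburger
        qed
        then have "u C x = t * u C1 x + s * u C2 x" by (simp add: w_def)
        then show ?thesis by (simp add: algebra_simps)
      qed (simp add: v_def)
      then have "S C D = t * S C1 D + s * S C2 D"
        by (simp add: S_def sum.distrib sum_distrib_left)
      moreover have "C1 \<inter> D \<subset> C \<inter> D" using Q1 by (simp add: Q_def)
      then have "S C1 D = 0" using less.hyps[OF psubset_card_mono[OF finCD] C1] by blast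
      moreover have "C2 \<inter> D \<subset> C \<inter> D" using C2(3) C1D eC2 eC e by blast
      then have "S C2 D = 0" using less.hyps[OF psubset_card_mono[OF finCD] C2(1)] by blast
      ultimately show ?thesis by simp
    qed
  qed
  have "signing M c d"
    unfolding signing_def using c d orth S0 S_eq by simp
  then show ?thesis unfolding signable_def by blast
qed

section \<open>Spaces of dependences over the fields with two and three elements\<close>

text \<open>The instances are the thin dependences and the linear dependences over the fields with two
  and three elements. The last assumption replaces linear compactness.\<close>

locale dependence_space = matroid M
  for M :: "'e set_system" +
  fixes L :: "('e \<Rightarrow> 'v::comm_ring_1) set" and q :: int
  assumes unit_cases: "(a::'v) = 0 \<or> a = 1 \<or> a = -1"
    and of_int_eq_0_iff: "of_int z = (0::'v) \<longleftrightarrow> q dvd z"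
    and support_subset_ground: "l \<in> L \<Longrightarrow> l x \<noteq> 0 \<Longrightarrow> x \<in> ground M"
    and combine: "l \<in> L \<Longrightarrow> m \<in> L \<Longrightarrow> (\<lambda>x. l x + a * m x) \<in> L"
    and indep_iff: "I \<subseteq> ground M \<Longrightarrow>
      I \<in> indep M \<longleftrightarrow> (\<forall>l\<in>L. (\<forall>x. l x \<noteq> 0 \<longrightarrow> x \<in> I) \<longrightarrow> (\<forall>x. l x = 0))"
    and closed: "l \<in> L \<Longrightarrow>
      (\<And>G. finite G \<Longrightarrow> \<exists>l'\<in>L. (\<forall>x. l' x \<noteq> 0 \<longrightarrow> l x \<noteq> 0) \<and> (\<forall>x\<in>G. l' x = m x)) \<Longrightarrow> m \<in> L"
begin

lemma mult_self: "x \<noteq> 0 \<Longrightarrow> x * x = (1::'v)"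
  using unit_cases[of x] by auto

lemma combine_sum:
  assumes "finite F" "l \<in> L" "\<And>g. g \<in> F \<Longrightarrow> h g \<in> L"
  shows "(\<lambda>x. l x + (\<Sum>g\<in>F. a g * h g x)) \<in> L"
  using assms
proof (induction F rule: finite_induct)
  case (insert g F)
  then have "(\<lambda>x. l x + (\<Sum>g\<in>F. a g * h g x)) \<in> L" "h g \<in> L" by simp_all
  from combine[OF this, of "a g"] show ?case
    using insert.hyps by (simp add: add_ac)
qed simp

text \<open>A nonzero dependence supported in \<open>C\<close> must use every \<open>x\<close> in
  \<open>C\<close>, because \<open>C - {x}\<close> is independent.\<close>

lemma circuit_vector:
  assumes C: "C \<in> circuits M"
  shows "\<exists>l. l \<in> L \<and> (\<forall>x. l x \<noteq> 0 \<longleftrightarrow> x \<in> C)"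
proof -
  have Cg: "C \<subseteq> ground M" by (rule circuit_subset_ground[OF C])
  obtain l y where l: "l \<in> L" "\<forall>x. l x \<noteq> 0 \<longrightarrow> x \<in> C" "l y \<noteq> 0"
    using circuit_dependent[OF C] indep_iff[OF Cg] by blast
  have "l x \<noteq> 0" if x: "x \<in> C" for x
  proof
    assume "l x = 0"
    then have "\<forall>z. l z \<noteq> 0 \<longrightarrow> z \<in> C - {x}" using l(2) by auto
    moreover have "C - {x} \<subseteq> ground M" using Cg by blast
    ultimately show False
      using circuit_remove_indep[OF C x] indep_iff[of "C - {x}"] l by blast
  qed
  then show ?thesis using l by blast
qed

text \<open>Otherwise a maximal independent \<open>J\<close> in the support without \<open>e\<close>
  stays independent when \<open>e\<close> is added. Clearing the rest of the support with circuit
  vectors yields, in the limit, a dependence supported in \<open>insert e J\<close> and still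
  nonzero at \<open>e\<close>.\<close>

lemma support_contains_circuit:
  assumes l: "l \<in> L" and e: "l e \<noteq> 0"
  shows "\<exists>C\<in>circuits M. e \<in> C \<and> (\<forall>x\<in>C. l x \<noteq> 0)"
proof (rule ccontr)
  assume no_circuit: "\<not> ?thesis"
  define X where "X = {x. l x \<noteq> 0}"
  have Xg: "X \<subseteq> ground M" using support_subset_ground[OF l] by (auto simp: X_def)
  obtain J where J: "J \<in> indep M" "J \<subseteq> X - {e}" "\<forall>x\<in>X - {e} - J. insert x J \<notin> indep M"
    using extend_maximal[OF I1, of "X - {e}"] Xg by blast
  have circ: "\<exists>C\<in>circuits M. C \<subseteq> insert x J \<and> x \<in> C" if "x \<in> X" "insert x J \<notin> indep M" for x
    using fundamental_circuit[OF J(1)] Xg that by blast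
  have eX: "e \<in> X" using e by (simp add: X_def)
  have eJ: "insert e J \<in> indep M"
  proof (rule ccontr)
    assume "insert e J \<notin> indep M"
    then obtain C where "C \<in> circuits M" "C \<subseteq> insert e J" "e \<in> C" using circ[OF eX] by blast
    then show False using no_circuit J(2) eX unfolding X_def by blast
  qed
  define K where "K = X - {e} - J"
  have "\<exists>h. h \<in> L \<and> h g \<noteq> 0 \<and> (\<forall>x. h x \<noteq> 0 \<longrightarrow> x \<in> insert g J)" if g: "g \<in> K" for g
  proof -
    obtain C where C: "C \<in> circuits M" "C \<subseteq> insert g J" "g \<in> C"
      using circ[of g] J(3) g unfolding K_def by blast
    then show ?thesis using circuit_vector[OF C(1)] by blast
  qed
  then obtain h where h: "\<And>g. g \<in> K \<Longrightarrow> h g \<in> L \<and> h g g \<noteq> 0 \<and> (\<forall>x. h g x \<noteq> 0 \<longrightarrow> x \<in> insert g J)"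
    by metis
  \<comment> \<open>Clears the coordinates in \<open>F \<inter> K\<close>. The factor
    \<open>h g g\<close> is its own inverse, and \<open>h g\<close> vanishes at \<open>e\<close> and
    on \<open>K\<close> except at \<open>g\<close>, so the corrections do not interfere. Clearing
    all of \<open>K\<close> at once might need an infinite sum, hence the net over finite
    \<open>F\<close>.\<close>
  define r where "r F x = l x + (\<Sum>g\<in>F \<inter> K. - (l g * h g g) * h g x)" for F x
  have rL: "r F \<in> L" if "finite F" for F
    unfolding r_def by (rule combine_sum[OF _ l]) (use that h in auto)
  have r_outside: "r F x = 0" if "x \<notin> X" for F x
  proof -
    have "h g x = 0" if "g \<in> F \<inter> K" for g
      using h[of g] that \<open>x \<notin> X\<close> J(2) by (auto simp: K_def)
    then show ?thesis using that by (simp add: r_def X_def)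
  qed
  have r_e: "r F e = l e" for F
  proof -
    have "h g e = 0" if "g \<in> F \<inter> K" for g
      using h[of g] that J(2) by (auto simp: K_def)
    then show ?thesis by (simp add: r_def)
  qed
  have r_K: "r F x = 0" if F: "finite F" "x \<in> F" and x: "x \<in> K" for F x
  proof -
    have "h g x = 0" if "g \<in> F \<inter> K - {x}" for g
      using h[of g] that x by (auto simp: K_def)
    then have "(\<Sum>g\<in>F \<inter> K. - (l g * h g g) * h g x) = - (l x * h x x) * h x x"
      using F x by (subst sum.remove[of _ x]) auto
    then show ?thesis using mult_self[of "h x x"] h[OF x] by (simp add: r_def mult.assoc)
  qed
  have "(UNIV :: 'v set) = {0, 1, -1}" using unit_cases by blast
  then have "finite (UNIV :: 'v set)" by (metis finite.emptyI finite.insertI)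
  then have "\<exists>m. \<forall>F G. finite F \<longrightarrow> finite G \<longrightarrow> (\<exists>F'. finite F' \<and> F \<subseteq> F' \<and> (\<forall>i\<in>G. r F' i = m i))"
    by (rule finite_net_cluster_point) simp
  then obtain m where
    m: "\<forall>F G. finite F \<longrightarrow> finite G \<longrightarrow> (\<exists>F'. finite F' \<and> F \<subseteq> F' \<and> (\<forall>i\<in>G. r F' i = m i))"
    by (elim exE) (rule that)
  note m = m[THEN spec, THEN spec, THEN mp, THEN mp]
  have "m \<in> L"
  proof (rule closed[OF l])
    fix G :: "'e set" assume "finite G"
    then obtain F where F: "finite F" "\<forall>i\<in>G. r F i = m i" using m[of "{}" G] by auto
    then show "\<exists>l'\<in>L. (\<forall>x. l' x \<noteq> 0 \<longrightarrow> l x \<noteq> 0) \<and> (\<forall>x\<in>G. l' x = m x)"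
      using rL[OF F(1)] r_outside unfolding X_def by (intro bexI[of _ "r F"]) auto
  qed
  moreover have "m x = 0" if x: "x \<notin> insert e J" for x
  proof -
    obtain F where F: "finite F" "x \<in> F" "r F x = m x" using m[of "{x}" "{x}"] by auto
    have "r F x = 0"
      using r_K[OF F(1,2)] r_outside[of x F] x unfolding K_def by blast
    then show ?thesis using F(3) by simp
  qed
  moreover have "insert e J \<subseteq> ground M" using eX J(2) Xg by blast
  ultimately have "m e = 0" using indep_iff[of "insert e J"] eJ by blast
  moreover obtain F where "r F e = m e" using m[of "{}" "{e}"] by auto
  ultimately show False using r_e[of F] e by simp
qed

lemma signable_mod_if_tame:
  assumes tame: "tame M"
  shows "signable_mod q M"
proof -
  have fin: "finite (C \<inter> D)" if "C \<in> circuits M" "D \<in> cocircuits M" for C D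
    using tame that by (auto simp: tame_def)
  obtain u where u: "\<And>C. C \<in> circuits M \<Longrightarrow> u C \<in> L \<and> (\<forall>x. u C x \<noteq> 0 \<longleftrightarrow> x \<in> C)"
    using circuit_vector by metis
  have "\<exists>b. b \<in> D" if "D \<in> cocircuits M" for D
    using matroid.circuit_nonempty[OF matroid_dual] that unfolding cocircuits_def by blast
  then obtain b where b: "\<And>D. D \<in> cocircuits M \<Longrightarrow> b D \<in> D" by metis
  have "\<exists>C. C \<in> circuits M \<and> C \<inter> D = {b D, f}" if "D \<in> cocircuits M" "f \<in> D" "f \<noteq> b D" for D f
    by (rule circuit_meets_cocircuit_twice[OF that(1) b[OF that(1)] that(2) that(3)[symmetric]]) blast
  then obtain w where w: "\<And>D f. D \<in> cocircuits M \<Longrightarrow> f \<in> D \<Longrightarrow> f \<noteq> b D \<Longrightarrow>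
      w D f \<in> circuits M \<and> w D f \<inter> D = {b D, f}"
    by metis
  \<comment> \<open>Normalised to 1 at \<open>b D\<close>. Orthogonality to the circuit
    \<open>w D f\<close>, which meets \<open>D\<close> only in \<open>b D\<close> and
    \<open>f\<close>, then dictates the value at \<open>f\<close>.\<close>
  define v where "v D f = (if f = b D then 1 else - (u (w D f) (b D) * u (w D f) f))" for D f
  have v: "v D f \<noteq> 0" if D: "D \<in> cocircuits M" "f \<in> D" for D f
  proof (cases "f = b D")
    case False
    have "b D \<in> w D f" "f \<in> w D f" using w[OF D False] by blast+
    then have "u (w D f) (b D) \<noteq> 0" "u (w D f) f \<noteq> 0" using u w[OF D False] by blast+
    then have "u (w D f) (b D) = 1 \<or> u (w D f) (b D) = -1" "u (w D f) f = 1 \<or> u (w D f) f = -1"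
      using unit_cases by blast+
    then show ?thesis using False by (auto simp: v_def)
  qed (simp add: v_def)
  have orth: "(\<Sum>x\<in>C \<inter> D. u C x * v D x) = 0" if C: "C \<in> circuits M" and D: "D \<in> cocircuits M" for C D
  proof -
    let ?T = "C \<inter> D - {b D}"
    have finT: "finite ?T" using fin[OF C D] by blast
    have wT: "w D f \<in> circuits M" "w D f \<inter> D = {b D, f}" if "f \<in> ?T" for f
      using w[OF D, of f] that by blast+
    \<comment> \<open>Multiples of the vectors of \<open>w D f\<close> clear
      \<open>C \<inter> D\<close> away from \<open>b D\<close>; tameness makes the sum finite. What
      is left at \<open>b D\<close> is exactly the pairing of \<open>C\<close> with
      \<open>D\<close>.\<close>
    define l where "l x = u C x + (\<Sum>f\<in>?T. - (u C f * u (w D f) f) * u (w D f) x)" for x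
    have lL: "l \<in> L"
      unfolding l_def by (rule combine_sum[OF finT]) (use u C wT in auto)
    have l_D: "l x = 0" if x: "x \<in> D" "x \<noteq> b D" for x
    proof -
      have *: "u (w D f) x = 0" if "f \<in> ?T" "f \<noteq> x" for f
      proof -
        have "x \<notin> w D f" using wT(2)[OF that(1)] x that(2) by blast
        then show ?thesis using u[OF wT(1)[OF that(1)]] by blast
      qed
      show ?thesis
      proof (cases "x \<in> C")
        case True
        then have xT: "x \<in> ?T" using x by blast
        then have "x \<in> w D x" using wT(2)[OF xT] by blast
        then have "u (w D x) x * u (w D x) x = 1" using u[OF wT(1)[OF xT]] mult_self by blast
        moreover have "(\<Sum>f\<in>?T. - (u C f * u (w D f) f) * u (w D f) x) = - (u C x * u (w D x) x) * u (w D x) x"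
          using * finT xT by (subst sum.remove[of _ x]) auto
        ultimately show ?thesis by (simp add: l_def mult.assoc)
      next
        case False
        then have "(\<Sum>f\<in>?T. - (u C f * u (w D f) f) * u (w D f) x) = 0"
          using * by (intro sum.neutral) (metis DiffD1 IntD1 mult_zero_right)
        moreover have "u C x = 0" using u[OF C] False by blast
        ultimately show ?thesis by (simp add: l_def)
      qed
    qed
    \<comment> \<open>Otherwise a circuit through \<open>b D\<close> in the support of
      \<open>l\<close> would meet \<open>D\<close> only in \<open>b D\<close>.\<close>
    have "l (b D) = 0"
    proof (rule ccontr)
      assume "l (b D) \<noteq> 0"
      then obtain C' where C': "C' \<in> circuits M" "b D \<in> C'" "\<forall>x\<in>C'. l x \<noteq> 0"
        using support_contains_circuit[OF lL] by blast
      then have "C' \<inter> D = {b D}" using l_D b[OF D] by blast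
      then show False using circuit_Int_cocircuit_not_singleton[OF C'(1) D] by blast
    qed
    moreover have "l (b D) = u C (b D) + (\<Sum>f\<in>?T. u C f * v D f)"
      unfolding l_def by (intro arg_cong2[of _ _ _ _ "(+)"] sum.cong) (auto simp: v_def mult_ac)
    moreover have "(\<Sum>x\<in>C \<inter> D. u C x * v D x) = u C (b D) + (\<Sum>f\<in>?T. u C f * v D f)"
    proof (cases "b D \<in> C")
      case True
      then show ?thesis using b[OF D] fin[OF C D] by (subst sum.remove[of _ "b D"]) (auto simp: v_def)
    next
      case False
      then have "?T = C \<inter> D" "u C (b D) = 0" using u[OF C] by blast+
      then show ?thesis by simp
    qed
    ultimately show ?thesis by simp
  qed
  \<comment> \<open>Integer representatives of nonzero elements. In characteristic 2, where 1 and -1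
    coincide, the representative is 1.\<close>
  define sg :: "'v \<Rightarrow> int" where "sg x = (if x = 1 then 1 else -1)" for x
  have sg: "of_int (sg x) = x" if "x \<noteq> 0" for x using unit_cases[of x] that by (auto simp: sg_def)
  have "q dvd (\<Sum>e\<in>C \<inter> D. sg (u C e) * sg (v D e))"
    if C: "C \<in> circuits M" and D: "D \<in> cocircuits M" for C D
  proof -
    have "of_int (\<Sum>e\<in>C \<inter> D. sg (u C e) * sg (v D e)) = (\<Sum>e\<in>C \<inter> D. u C e * v D e)"
      using u[OF C] v[OF D] by (simp add: sg)
    then show ?thesis using orth[OF C D] of_int_eq_0_iff by metis
  qed
  moreover have "sg x \<in> {1, -1}" for x by (simp add: sg_def)
  ultimately show ?thesis
    unfolding signable_mod_def
    by (intro exI[of _ "\<lambda>C e. sg (u C e)"] exI[of _ "\<lambda>D e. sg (v D e)"] conjI ballI fin)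
qed

end

section \<open>Copies of the two small fields and their spaces of dependences\<close>

definition ring_copy :: "('v::comm_ring_1 \<Rightarrow> 'k) \<Rightarrow> 'k ring" where
  "ring_copy h = \<lparr>carrier = range h,
     monoid.mult = (\<lambda>x y. h (the_inv h x * the_inv h y)), one = h 1, zero = h 0,
     add = (\<lambda>x y. h (the_inv h x + the_inv h y))\<rparr>"

text \<open>Fields in the theorem have carriers inside \<open>'k\<close>, so the residue rings are
  transported along an injection. \<open>unit_cases\<close> turns the copy into a field, since every
  nonzero element is its own inverse.\<close>

locale unit_field_copy =
  fixes h :: "'v::comm_ring_1 \<Rightarrow> 'k"
  assumes inj: "inj h"
    and unit_cases: "(a::'v) = 0 \<or> a = 1 \<or> a = -1"
begin

abbreviation "k \<equiv> ring_copy h"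

lemma copy_simps [simp]:
  "carrier k = range h" "\<zero>\<^bsub>k\<^esub> = h 0" "\<one>\<^bsub>k\<^esub> = h 1"
  "h a \<oplus>\<^bsub>k\<^esub> h b = h (a + b)" "h a \<otimes>\<^bsub>k\<^esub> h b = h (a * b)"
  by (simp_all add: ring_copy_def the_inv_f_f[OF inj])

lemma h_eq_iff [simp]: "h a = h b \<longleftrightarrow> a = b"
  using inj by (rule inj_eq)

lemma the_inv_h [simp]: "the_inv h (h a) = a"
  by (rule the_inv_f_f[OF inj])

lemma h_the_inv [simp]: "x \<in> range h \<Longrightarrow> h (the_inv h x) = x"
  by auto

lemma mult_eq_0_iff: "(a::'v) * b = 0 \<longleftrightarrow> a = 0 \<or> b = 0"
  using unit_cases[of a] unit_cases[of b] by auto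

lemma field_copy: "field k"
proof -
  have "cring k"
  proof (rule cringI)
    show "abelian_group k"
    proof (rule abelian_groupI)
      fix x assume "x \<in> carrier k"
      then obtain a where "x = h a" by auto
      then show "\<exists>y\<in>carrier k. y \<oplus>\<^bsub>k\<^esub> x = \<zero>\<^bsub>k\<^esub>" by (intro bexI[of _ "h (- a)"]) auto
    qed (auto simp: add_ac)
    show "comm_monoid k" by (rule comm_monoidI) (auto simp: mult_ac)
  qed (auto simp: algebra_simps)
  then interpret cring k .
  show ?thesis
  proof (rule cring_fieldI2)
    fix x assume "x \<in> carrier k" "x \<noteq> \<zero>\<^bsub>k\<^esub>"
    then obtain a where "x = h a" "a \<noteq> 0" by auto
    then show "\<exists>b\<in>carrier k. x \<otimes>\<^bsub>k\<^esub> b = \<one>\<^bsub>k\<^esub>"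
      using unit_cases[of a] by (intro bexI[of _ "h a"]) auto
  qed simp
qed

sublocale field k
  by (rule field_copy)

lemma finsum_copy: "finite S \<Longrightarrow> finsum k (\<lambda>e. h (g e)) S = h (\<Sum>e\<in>S. g e)"
  by (induction S rule: finite_induct) (simp_all add: finsum_insert Pi_def)

text \<open>The condition on a thin dependence at a single point of \<open>A\<close>, pulled back
  from the copy; \<open>r\<close> lists the values of the family at that point.\<close>

definition thin :: "'e set \<Rightarrow> ('e \<Rightarrow> 'v) \<Rightarrow> ('e \<Rightarrow> 'v) \<Rightarrow> bool" where
  "thin E r l \<longleftrightarrow> finite {e \<in> E. l e * r e \<noteq> 0} \<and> (\<Sum>e | e \<in> E \<and> l e * r e \<noteq> 0. l e * r e) = 0"

lemma thin_dependence_iff: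
  assumes f: "\<forall>e\<in>E. \<forall>a\<in>A. f e a \<in> carrier k"
  shows "thin_dependence k E A f (\<lambda>e. h (l e)) \<longleftrightarrow> (\<forall>a\<in>A. thin E (\<lambda>e. the_inv h (f e a)) l)"
proof -
  have eq: "h (l e) \<otimes>\<^bsub>k\<^esub> f e a = h (l e * the_inv h (f e a))" if "e \<in> E" "a \<in> A" for e a
  proof -
    have "f e a = h (the_inv h (f e a))" using f that by simp
    then show ?thesis by (metis copy_simps(5))
  qed
  have "finite {e \<in> E. h (l e) \<otimes>\<^bsub>k\<^esub> f e a \<noteq> \<zero>\<^bsub>k\<^esub>} \<and>
        (\<Oplus>\<^bsub>k\<^esub>e\<in>{e \<in> E. h (l e) \<otimes>\<^bsub>k\<^esub> f e a \<noteq> \<zero>\<^bsub>k\<^esub>}. h (l e) \<otimes>\<^bsub>k\<^esub> f e a) = \<zero>\<^bsub>k\<^esub> \<longleftrightarrow>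
      thin E (\<lambda>e. the_inv h (f e a)) l" if a: "a \<in> A" for a
  proof -
    have S: "{e \<in> E. h (l e) \<otimes>\<^bsub>k\<^esub> f e a \<noteq> \<zero>\<^bsub>k\<^esub>} = {e \<in> E. l e * the_inv h (f e a) \<noteq> 0}" (is "_ = ?S")
      using eq[OF _ a] by auto
    have "(\<Oplus>\<^bsub>k\<^esub>e\<in>?S. h (l e) \<otimes>\<^bsub>k\<^esub> f e a) = (\<Oplus>\<^bsub>k\<^esub>e\<in>?S. h (l e * the_inv h (f e a)))"
      using eq[OF _ a] by (intro finsum_cong') auto
    then show ?thesis unfolding S thin_def using finsum_copy[of ?S] by auto
  qed
  then show ?thesis by (auto simp: thin_dependence_def)
qed

lemma thin_combine:
  assumes l: "thin E r l" and m: "thin E r m"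
  shows "thin E r (\<lambda>e. l e + a * m e)"
proof -
  let ?S = "\<lambda>l. {e \<in> E. l e * r e \<noteq> 0}"
  let ?T = "?S l \<union> ?S m" and ?n = "\<lambda>e. l e + a * m e"
  have fin: "finite ?T" using l m by (auto simp: thin_def)
  have "?n e * r e = 0" if "l e * r e = 0" "m e * r e = 0" for e
    using that by (simp add: distrib_right mult.assoc)
  then have sub: "?S ?n \<subseteq> ?T" by blast
  have sum: "(\<Sum>e\<in>?S l'. l' e * r e) = (\<Sum>e\<in>?T. l' e * r e)" if "?S l' \<subseteq> ?T" for l'
    by (rule sum.mono_neutral_left[OF fin that]) auto
  have "(\<Sum>e\<in>?S ?n. ?n e * r e) = (\<Sum>e\<in>?T. l e * r e) + a * (\<Sum>e\<in>?T. m e * r e)"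
    unfolding sum[OF sub] by (simp add: distrib_right sum.distrib sum_distrib_left mult.assoc)
  also have "\<dots> = 0" using sum[of l] sum[of m] l m by (simp add: thin_def)
  finally show ?thesis using finite_subset[OF sub fin] by (simp add: thin_def)
qed

text \<open>Where \<open>l e * r e = 0\<close>, either \<open>r e\<close> vanishes or
  \<open>l\<close>, \<open>l'\<close> and \<open>m\<close> all do. Only the remaining positions
  matter, and there are finitely many of them when \<open>l\<close> is thin; this is why limits in
  \<open>closed\<close> are confined to the support of \<open>l\<close>.\<close>

lemma thin_closed:
  assumes sub: "\<And>e. m e \<noteq> 0 \<Longrightarrow> l e \<noteq> 0"
    and l': "thin E r l'" "\<And>e. l' e \<noteq> 0 \<Longrightarrow> l e \<noteq> 0"
    and eq: "\<And>e. e \<in> E \<Longrightarrow> l e * r e \<noteq> 0 \<Longrightarrow> l' e = m e"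
  shows "thin E r m"
proof -
  have *: "l' e * r e = m e * r e" if "e \<in> E" for e
  proof (cases "l e * r e = 0")
    case True
    then consider "r e = 0" | "l e = 0" using mult_eq_0_iff by blast
    then show ?thesis
    proof cases
      case 2
      then have "l' e = 0" "m e = 0" using sub l'(2) by blast+
      then show ?thesis by simp
    qed simp
  qed (use that eq in simp)
  then have S: "{e \<in> E. l' e * r e \<noteq> 0} = {e \<in> E. m e * r e \<noteq> 0}" by auto
  have "(\<Sum>e | e \<in> E \<and> m e * r e \<noteq> 0. l' e * r e) = (\<Sum>e | e \<in> E \<and> m e * r e \<noteq> 0. m e * r e)"
    using * by (intro sum.cong) auto
  then show ?thesis using l'(1) unfolding thin_def S by simp
qed

lemma dependence_space_thin:
  assumes M: "matroid M" and q: "\<And>z. of_int z = (0::'v) \<longleftrightarrow> q dvd z"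
    and f: "\<forall>e\<in>ground M. \<forall>a\<in>A. f e a \<in> carrier k"
    and ind: "indep M = {I. thinly_independent k (ground M) A f I}"
  shows "dependence_space M
    {l. (\<forall>x. l x \<noteq> 0 \<longrightarrow> x \<in> ground M) \<and> (\<forall>a\<in>A. thin (ground M) (\<lambda>e. the_inv h (f e a)) l)} q"
    (is "dependence_space M ?L q")
proof -
  interpret M: matroid M by (rule M)
  let ?r = "\<lambda>a e. the_inv h (f e a)"
  show ?thesis
  proof
    show "a = 0 \<or> a = 1 \<or> a = -1" for a :: 'v by (rule unit_cases)
    show "of_int z = (0::'v) \<longleftrightarrow> q dvd z" for z by (rule q)
    show "l \<in> ?L \<Longrightarrow> l x \<noteq> 0 \<Longrightarrow> x \<in> ground M" for l x by blast
    show "(\<lambda>x. l x + a * m x) \<in> ?L" if l: "l \<in> ?L" and m: "m \<in> ?L" for l m a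
    proof -
      have "x \<in> ground M" if x: "l x + a * m x \<noteq> 0" for x
      proof (rule ccontr)
        assume "x \<notin> ground M"
        then have "l x = 0" "m x = 0" using l m by blast+
        then show False using x by simp
      qed
      then show ?thesis using thin_combine l m by blast
    qed
    show "m \<in> ?L" if l: "l \<in> ?L" and
      m: "\<And>G. finite G \<Longrightarrow> \<exists>l'\<in>?L. (\<forall>x. l' x \<noteq> 0 \<longrightarrow> l x \<noteq> 0) \<and> (\<forall>x\<in>G. l' x = m x)" for l m
    proof -
      have sub: "l x \<noteq> 0" if "m x \<noteq> 0" for x
      proof -
        obtain l' where "\<forall>x. l' x \<noteq> 0 \<longrightarrow> l x \<noteq> 0" "l' x = m x" using m[of "{x}"] by auto
        then show ?thesis using that by simp
      qed
      have "thin (ground M) (?r a) m" if a: "a \<in> A" for a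
      proof -
        \<comment> \<open>The finite set on which \<open>m\<close> has to be approximated depends on
          \<open>a\<close>, and so does the approximating \<open>l'\<close>.\<close>
        have l_thin: "thin (ground M) (?r a) l" using l a by blast
        then have "finite {e \<in> ground M. l e * ?r a e \<noteq> 0}" by (simp add: thin_def)
        from m[OF this] obtain l' where l': "l' \<in> ?L" "\<forall>x. l' x \<noteq> 0 \<longrightarrow> l x \<noteq> 0"
          "\<forall>x\<in>{e \<in> ground M. l e * ?r a e \<noteq> 0}. l' x = m x"
          by blast
        show ?thesis
        proof (rule thin_closed[where l = l and l' = l'])
          show "l e \<noteq> 0" if "m e \<noteq> 0" for e by (rule sub[OF that])
          show "thin (ground M) (?r a) l'" using l'(1) a by blast
          show "l e \<noteq> 0" if "l' e \<noteq> 0" for e using l'(2) that by blast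
          show "l' e = m e" if "e \<in> ground M" "l e * ?r a e \<noteq> 0" for e using l'(3) that by blast
        qed
      qed
      moreover have "x \<in> ground M" if "m x \<noteq> 0" for x using sub[OF that] l by blast
      ultimately show ?thesis by blast
    qed
    show "I \<in> indep M \<longleftrightarrow> (\<forall>l\<in>?L. (\<forall>x. l x \<noteq> 0 \<longrightarrow> x \<in> I) \<longrightarrow> (\<forall>x. l x = 0))"
      if I: "I \<subseteq> ground M" for I
    proof
      assume "I \<in> indep M"
      then have thi: "thinly_independent k (ground M) A f I" by (simp add: ind)
      show "\<forall>l\<in>?L. (\<forall>x. l x \<noteq> 0 \<longrightarrow> x \<in> I) \<longrightarrow> (\<forall>x. l x = 0)"
      proof (intro ballI impI)
        fix l assume l: "l \<in> ?L" and lI: "\<forall>x. l x \<noteq> 0 \<longrightarrow> x \<in> I"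
        have "thin_dependence k (ground M) A f (\<lambda>e. h (l e))"
          using l by (simp add: thin_dependence_iff[OF f])
        moreover have "\<forall>e\<in>ground M - I. h (l e) = \<zero>\<^bsub>k\<^esub>" using lI by auto
        ultimately have "\<forall>e\<in>ground M. h (l e) = \<zero>\<^bsub>k\<^esub>"
          using thi unfolding thinly_independent_def by blast
        then show "\<forall>x. l x = 0" using l by auto
      qed
    next
      assume R: "\<forall>l\<in>?L. (\<forall>x. l x \<noteq> 0 \<longrightarrow> x \<in> I) \<longrightarrow> (\<forall>x. l x = 0)"
      have "\<forall>e\<in>ground M. l e = \<zero>\<^bsub>k\<^esub>"
        if l: "thin_dependence k (ground M) A f l" and lI: "\<forall>e\<in>ground M - I. l e = \<zero>\<^bsub>k\<^esub>" for l
      proof -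
        have lc: "l e = h (the_inv h (l e))" if "e \<in> ground M" for e
          using l that by (auto simp: thin_dependence_def Pi_iff)
        \<comment> \<open>A thin dependence is unconstrained outside the ground set, whereas members
          of \<open>?L\<close> vanish there.\<close>
        define l' where "l' e = (if e \<in> ground M then the_inv h (l e) else 0)" for e
        have hl': "h (l' e) = l e" if "e \<in> ground M" for e using lc[OF that] that by (simp add: l'_def)
        have *: "{e \<in> ground M. h (l' e) \<otimes>\<^bsub>k\<^esub> f e a \<noteq> \<zero>\<^bsub>k\<^esub>} = {e \<in> ground M. l e \<otimes>\<^bsub>k\<^esub> f e a \<noteq> \<zero>\<^bsub>k\<^esub>}" for a
          using hl' by auto
        have "(\<Oplus>\<^bsub>k\<^esub>e\<in>{e \<in> ground M. l e \<otimes>\<^bsub>k\<^esub> f e a \<noteq> \<zero>\<^bsub>k\<^esub>}. h (l' e) \<otimes>\<^bsub>k\<^esub> f e a) =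
            (\<Oplus>\<^bsub>k\<^esub>e\<in>{e \<in> ground M. l e \<otimes>\<^bsub>k\<^esub> f e a \<noteq> \<zero>\<^bsub>k\<^esub>}. l e \<otimes>\<^bsub>k\<^esub> f e a)" if "a \<in> A" for a
        proof (rule finsum_cong'[OF refl])
          show "(\<lambda>e. l e \<otimes>\<^bsub>k\<^esub> f e a) \<in> {e \<in> ground M. l e \<otimes>\<^bsub>k\<^esub> f e a \<noteq> \<zero>\<^bsub>k\<^esub>} \<rightarrow> carrier k"
            using l f that by (intro funcsetI m_closed) (auto simp: thin_dependence_def Pi_iff simp del: copy_simps)
        qed (simp add: hl')
        then have "thin_dependence k (ground M) A f (\<lambda>e. h (l' e))"
          using l unfolding thin_dependence_def * by simp
        then have "\<forall>a\<in>A. thin (ground M) (?r a) l'" by (simp add: thin_dependence_iff[OF f])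
        moreover have "\<forall>x. l' x \<noteq> 0 \<longrightarrow> x \<in> ground M" by (simp add: l'_def)
        ultimately have "l' \<in> ?L" by blast
        moreover have "\<forall>x. l' x \<noteq> 0 \<longrightarrow> x \<in> I"
        proof (intro allI impI, rule ccontr)
          fix x assume x: "l' x \<noteq> 0" "x \<notin> I"
          then have "x \<in> ground M" by (simp add: l'_def split: if_splits)
          then have "h (l' x) = h 0" using hl' lI x by simp
          then show False using x by simp
        qed
        ultimately have "\<forall>x. l' x = 0" using R by blast
        then show ?thesis using hl' by (metis copy_simps(2))
      qed
      then show "I \<in> indep M" using I by (simp add: ind thinly_independent_def)
    qed
  qed
qed

text \<open>Linear dependences are padded with zeros to the whole ground set. Closure is then
  immediate, since the finite ground set is itself an admissible \<open>G\<close>.\<close>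

lemma dependence_space_linear:
  assumes M: "matroid M" and q: "\<And>z. of_int z = (0::'v) \<longleftrightarrow> q dvd z"
    and fin: "finite (ground M)" and V: "Module.module k V" and v: "v \<in> ground M \<rightarrow> carrier V"
    and ind: "indep M = {I. I \<subseteq> ground M \<and> linearly_independent k V v I}"
  shows "dependence_space M
    {l. (\<forall>x. l x \<noteq> 0 \<longrightarrow> x \<in> ground M) \<and> (\<Oplus>\<^bsub>V\<^esub>e\<in>ground M. h (l e) \<odot>\<^bsub>V\<^esub> v e) = \<zero>\<^bsub>V\<^esub>} q"
    (is "dependence_space M ?L q")
proof -
  interpret M: matroid M by (rule M)
  interpret V: Module.module k V by (rule V)
  let ?E = "ground M"
  have vc: "v e \<in> carrier V" if "e \<in> ?E" for e using v that by auto
  have hc: "h a \<in> carrier k" for a by simp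
  have sc: "h a \<odot>\<^bsub>V\<^esub> v e \<in> carrier V" if "e \<in> ?E" for a e by (rule V.smult_closed[OF hc vc[OF that]])
  have z: "h 0 \<odot>\<^bsub>V\<^esub> v e = \<zero>\<^bsub>V\<^esub>" if "e \<in> ?E" for e using V.smult_l_null[OF vc[OF that]] by simp
  have restrict: "(\<Oplus>\<^bsub>V\<^esub>e\<in>J. h (l e) \<odot>\<^bsub>V\<^esub> v e) = (\<Oplus>\<^bsub>V\<^esub>e\<in>?E. h (l e) \<odot>\<^bsub>V\<^esub> v e)"
    if J: "J \<subseteq> ?E" and l: "\<And>x. l x \<noteq> 0 \<Longrightarrow> x \<in> J" for J l
    by (rule V.M.add.finprod_mono_neutral_cong_left[OF fin J])
      (use sc z l in \<open>force+\<close>)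
  show ?thesis
  proof
    show "a = 0 \<or> a = 1 \<or> a = -1" for a :: 'v by (rule unit_cases)
    show "of_int z = (0::'v) \<longleftrightarrow> q dvd z" for z by (rule q)
    show "l \<in> ?L \<Longrightarrow> l x \<noteq> 0 \<Longrightarrow> x \<in> ground M" for l x by blast
    show "(\<lambda>x. l x + a * m x) \<in> ?L" if l: "l \<in> ?L" and m: "m \<in> ?L" for l m a
    proof -
      have "x \<in> ground M" if x: "l x + a * m x \<noteq> 0" for x
      proof (rule ccontr)
        assume "x \<notin> ground M"
        then have "l x = 0" "m x = 0" using l m by blast+
        then show False using x by simp
      qed
      moreover have "(\<Oplus>\<^bsub>V\<^esub>e\<in>?E. h (l e + a * m e) \<odot>\<^bsub>V\<^esub> v e) = \<zero>\<^bsub>V\<^esub>"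
      proof -
        have "(\<Oplus>\<^bsub>V\<^esub>e\<in>?E. h (l e + a * m e) \<odot>\<^bsub>V\<^esub> v e) =
            (\<Oplus>\<^bsub>V\<^esub>e\<in>?E. h (l e) \<odot>\<^bsub>V\<^esub> v e \<oplus>\<^bsub>V\<^esub> h a \<odot>\<^bsub>V\<^esub> (h (m e) \<odot>\<^bsub>V\<^esub> v e))"
        proof (rule V.M.finsum_cong'[OF refl])
          show "(\<lambda>e. h (l e) \<odot>\<^bsub>V\<^esub> v e \<oplus>\<^bsub>V\<^esub> h a \<odot>\<^bsub>V\<^esub> (h (m e) \<odot>\<^bsub>V\<^esub> v e)) \<in> ?E \<rightarrow> carrier V"
            using vc by (intro funcsetI V.M.a_closed V.smult_closed hc) auto
          fix e assume e: "e \<in> ?E"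
          have "h (l e + a * m e) \<odot>\<^bsub>V\<^esub> v e = (h (l e) \<oplus>\<^bsub>k\<^esub> h a \<otimes>\<^bsub>k\<^esub> h (m e)) \<odot>\<^bsub>V\<^esub> v e" by simp
          also have "\<dots> = h (l e) \<odot>\<^bsub>V\<^esub> v e \<oplus>\<^bsub>V\<^esub> (h a \<otimes>\<^bsub>k\<^esub> h (m e)) \<odot>\<^bsub>V\<^esub> v e"
            by (rule V.smult_l_distr) (use vc[OF e] in auto)
          also have "(h a \<otimes>\<^bsub>k\<^esub> h (m e)) \<odot>\<^bsub>V\<^esub> v e = h a \<odot>\<^bsub>V\<^esub> (h (m e) \<odot>\<^bsub>V\<^esub> v e)"
            by (rule V.smult_assoc1) (use vc[OF e] in auto)
          finally show "h (l e + a * m e) \<odot>\<^bsub>V\<^esub> v e =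
              h (l e) \<odot>\<^bsub>V\<^esub> v e \<oplus>\<^bsub>V\<^esub> h a \<odot>\<^bsub>V\<^esub> (h (m e) \<odot>\<^bsub>V\<^esub> v e)" .
        qed
        also have "\<dots> = (\<Oplus>\<^bsub>V\<^esub>e\<in>?E. h (l e) \<odot>\<^bsub>V\<^esub> v e) \<oplus>\<^bsub>V\<^esub> (\<Oplus>\<^bsub>V\<^esub>e\<in>?E. h a \<odot>\<^bsub>V\<^esub> (h (m e) \<odot>\<^bsub>V\<^esub> v e))"
          using vc by (intro V.M.finsum_addf funcsetI V.smult_closed hc) auto
        also have "(\<Oplus>\<^bsub>V\<^esub>e\<in>?E. h a \<odot>\<^bsub>V\<^esub> (h (m e) \<odot>\<^bsub>V\<^esub> v e)) = h a \<odot>\<^bsub>V\<^esub> (\<Oplus>\<^bsub>V\<^esub>e\<in>?E. h (m e) \<odot>\<^bsub>V\<^esub> v e)"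
          using sc by (intro V.finsum_smult_ldistr[symmetric] fin hc funcsetI) auto
        finally show ?thesis using l m V.smult_r_null[OF hc] by simp
      qed
      ultimately show ?thesis by blast
    qed
    show "m \<in> ?L" if l: "l \<in> ?L" and
      m: "\<And>G. finite G \<Longrightarrow> \<exists>l'\<in>?L. (\<forall>x. l' x \<noteq> 0 \<longrightarrow> l x \<noteq> 0) \<and> (\<forall>x\<in>G. l' x = m x)" for l m
    proof -
      obtain l' where l': "l' \<in> ?L" "\<forall>x\<in>?E. l' x = m x" using m[OF fin] by blast
      have out: "x \<in> ?E" if mx: "m x \<noteq> 0" for x
      proof -
        obtain l'' where "\<forall>x. l'' x \<noteq> 0 \<longrightarrow> l x \<noteq> 0" "l'' x = m x" using m[of "{x}"] by auto
        then have "l x \<noteq> 0" using mx by simp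
        then show ?thesis using l by blast
      qed
      have "l' x = m x" for x
      proof (cases "x \<in> ?E")
        case False
        then have "l' x = 0" "m x = 0" using l'(1) out[of x] by blast+
        then show ?thesis by simp
      qed (use l'(2) in blast)
      then have "l' = m" ..
      then show ?thesis using l'(1) by simp
    qed
    show "I \<in> indep M \<longleftrightarrow> (\<forall>l\<in>?L. (\<forall>x. l x \<noteq> 0 \<longrightarrow> x \<in> I) \<longrightarrow> (\<forall>x. l x = 0))"
      if I: "I \<subseteq> ground M" for I
    proof
      assume "I \<in> indep M"
      then have li: "linearly_independent k V v I" by (simp add: ind)
      show "\<forall>l\<in>?L. (\<forall>x. l x \<noteq> 0 \<longrightarrow> x \<in> I) \<longrightarrow> (\<forall>x. l x = 0)"
      proof (intro ballI impI)
        fix l assume l: "l \<in> ?L" and lI: "\<forall>x. l x \<noteq> 0 \<longrightarrow> x \<in> I"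
        have "(\<Oplus>\<^bsub>V\<^esub>e\<in>I. h (l e) \<odot>\<^bsub>V\<^esub> v e) = \<zero>\<^bsub>V\<^esub>" using restrict[OF I, of l] lI l by auto
        moreover have "finite I" by (rule finite_subset[OF I fin])
        moreover have "(\<lambda>e. h (l e)) \<in> I \<rightarrow> carrier k" by simp
        ultimately have "\<forall>e\<in>I. h (l e) = \<zero>\<^bsub>k\<^esub>"
          using li[unfolded linearly_independent_def, THEN spec, THEN spec, of I "\<lambda>e. h (l e)"] by blast
        then show "\<forall>x. l x = 0" using lI by auto
      qed
    next
      assume R: "\<forall>l\<in>?L. (\<forall>x. l x \<noteq> 0 \<longrightarrow> x \<in> I) \<longrightarrow> (\<forall>x. l x = 0)"
      have "\<forall>e\<in>J. c e = \<zero>\<^bsub>k\<^esub>"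
        if J: "J \<subseteq> I" and c: "c \<in> J \<rightarrow> carrier k" and s: "(\<Oplus>\<^bsub>V\<^esub>e\<in>J. c e \<odot>\<^bsub>V\<^esub> v e) = \<zero>\<^bsub>V\<^esub>" for J c
      proof -
        define l where "l x = (if x \<in> J then the_inv h (c x) else 0)" for x
        have hl: "h (l x) = c x" if "x \<in> J" for x using c that by (auto simp: l_def Pi_iff)
        have lJ: "x \<in> J" if "l x \<noteq> 0" for x using that by (simp add: l_def split: if_splits)
        have "(\<Oplus>\<^bsub>V\<^esub>e\<in>J. h (l e) \<odot>\<^bsub>V\<^esub> v e) = (\<Oplus>\<^bsub>V\<^esub>e\<in>J. c e \<odot>\<^bsub>V\<^esub> v e)"
          using hl c J I vc by (intro V.M.finsum_cong' refl funcsetI V.smult_closed) auto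
        moreover have "(\<Oplus>\<^bsub>V\<^esub>e\<in>J. h (l e) \<odot>\<^bsub>V\<^esub> v e) = (\<Oplus>\<^bsub>V\<^esub>e\<in>?E. h (l e) \<odot>\<^bsub>V\<^esub> v e)"
          by (rule restrict) (use J I lJ in auto)
        ultimately have "l \<in> ?L" using s lJ J I by auto
        then have "\<forall>x. l x = 0" using R lJ J by blast
        then show ?thesis using hl by (metis copy_simps(2))
      qed
      then have "linearly_independent k V v I" unfolding linearly_independent_def by blast
      then show "I \<in> indep M" using I by (simp add: ind)
    qed
  qed
qed

lemma signable_mod_if_thin_sums:
  assumes "matroid M" "tame M" "\<And>z. of_int z = (0::'v) \<longleftrightarrow> q dvd z" "thin_sums_over k M"
  shows "signable_mod q M"
proof -
  obtain A and f :: "'a \<Rightarrow> ('a \<Rightarrow> 'k) \<Rightarrow> 'k" where "\<forall>e\<in>ground M. \<forall>a\<in>A. f e a \<in> carrier k"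
    "indep M = {I. thinly_independent k (ground M) A f I}"
    using assms(4) unfolding thin_sums_over_def by blast
  from dependence_space.signable_mod_if_tame[OF dependence_space_thin[OF assms(1,3) this] assms(2)]
  show ?thesis .
qed

lemma signable_mod_if_representable:
  assumes "matroid M" "finite (ground M)" "\<And>z. of_int z = (0::'v) \<longleftrightarrow> q dvd z" "representable_over k M"
  shows "signable_mod q M"
proof -
  obtain V :: "('k, 'a \<Rightarrow> 'k) module" and v where "Module.module k V" "v \<in> ground M \<rightarrow> carrier V"
    "indep M = {I. I \<subseteq> ground M \<and> linearly_independent k V v I}"
    using assms(4) unfolding representable_over_def by blast
  from dependence_space.signable_mod_if_tame[OF dependence_space_linear[OF assms(1,3,2) this]
      matroid.tame_finite_ground[OF assms(1,2)]]
  show ?thesis .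
qed

end

section \<open>Residues modulo two and three\<close>

lemma of_int_eq_0_iff_2: "of_int z = (0::2) \<longleftrightarrow> 2 dvd z"
  by (simp add: of_int_eq_0_iff_char_dvd)

lemma of_int_eq_0_iff_3: "of_int z = (0::3) \<longleftrightarrow> 3 dvd z"
  by (simp add: of_int_eq_0_iff_char_dvd)

lemma unit_cases_2: "(a::2) = 0 \<or> a = 1 \<or> a = -1"
proof (cases a)
  case (of_int z)
  then have "z = 0 \<or> z = 1" by auto
  then show ?thesis using of_int by auto
qed

lemma unit_cases_3: "(a::3) = 0 \<or> a = 1 \<or> a = -1"
proof (cases a)
  case (of_int z)
  then have "z = 0 \<or> z = 1 \<or> z = 2" by auto
  then show ?thesis using of_int by auto
qed

lemma inj_into_infinite:
  assumes "infinite (UNIV :: 'k set)"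
  shows "\<exists>h :: 'v::finite \<Rightarrow> 'k. inj h"
proof -
  obtain B :: "'k set" where "finite B" "card B = CARD('v)"
    using infinite_arbitrarily_large[OF assms] by blast
  then obtain h :: "'v \<Rightarrow> 'k" where "bij_betw h UNIV B"
    using finite_same_card_bij[of "UNIV :: 'v set" B] by auto
  then show ?thesis by (auto simp: bij_betw_def)
qed

section \<open>Representations from signings\<close>

definition field_sign :: "('k, 'm) ring_scheme \<Rightarrow> int \<Rightarrow> 'k" where
  "field_sign k z = (if z = 1 then \<one>\<^bsub>k\<^esub> else \<ominus>\<^bsub>k\<^esub> \<one>\<^bsub>k\<^esub>)"

context field
begin

lemma field_sign_closed [simp]: "field_sign R z \<in> carrier R"
  by (simp add: field_sign_def)

lemma field_sign_nonzero [simp]: "field_sign R z \<noteq> \<zero>"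
  using one_not_zero by (simp add: field_sign_def add.inv_eq_1_iff)

lemma field_sign_mult:
  "x \<in> {1, -1} \<Longrightarrow> y \<in> {1, -1} \<Longrightarrow> field_sign R x \<otimes> field_sign R y = field_sign R (x * y)"
  by (auto simp: field_sign_def l_minus r_minus)

text \<open>The field sum of signs is the image of their integer sum, so an identity over the
  integers holds in every characteristic.\<close>

lemma finsum_field_sign:
  assumes "finite S" "\<And>e. e \<in> S \<Longrightarrow> g e \<in> {1, -1}"
  shows "(\<Oplus>e\<in>S. field_sign R (g e)) = add_pow R (\<Sum>e\<in>S. g e) \<one>"
  using assms
proof (induction S rule: finite_induct)
  case (insert x S)
  have "field_sign R (g x) = add_pow R (g x) \<one>"
    using insert.prems[of x] by (auto simp: field_sign_def add.int_pow_neg)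
  then show ?case
    using insert by (simp add: add.int_pow_mult)
qed (simp add: add_pow_int_ge)

end

text \<open>Independence is certified by cocircuits that meet the set in one prescribed element,
  dependence by the sign vector of a circuit.\<close>

lemma thin_sums_over_if_signable:
  fixes M :: "'e set_system" and R :: "'k ring" (structure)
  assumes R: "field R" and M: "matroid M" and s: "signable M"
  shows "thin_sums_over R M"
proof -
  interpret field R by (rule R)
  interpret M: matroid M by (rule M)
  let ?E = "ground M"
  have "signable_mod 0 M" using s by (simp add: signable_iff_mod_0)
  then obtain c d :: "'e set \<Rightarrow> 'e \<Rightarrow> int" where c: "\<forall>C\<in>circuits M. \<forall>e\<in>C. c C e \<in> {1, -1}"
    and d: "\<forall>D\<in>cocircuits M. \<forall>e\<in>D. d D e \<in> {1, -1}"
    and orth: "\<forall>C\<in>circuits M. \<forall>D\<in>cocircuits M.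
      finite (C \<inter> D) \<and> 0 dvd (\<Sum>e\<in>C \<inter> D. c C e * d D e)"
    by (rule signable_modE)
  define f where "f e D = (if e \<in> D then field_sign R (d D e) else \<zero>)" for e D
  have f_closed: "f e D \<in> carrier R" for e D by (simp add: f_def)
  have "thinly_independent R ?E (cocircuits M) f I" if I: "I \<in> indep M" for I
    unfolding thinly_independent_def
  proof (intro conjI allI impI ballI)
    show "I \<subseteq> ?E" by (rule M.indep_subset_ground[OF I])
    fix l e assume l: "thin_dependence R ?E (cocircuits M) f l \<and> (\<forall>e\<in>?E - I. l e = \<zero>)" and e: "e \<in> ?E"
    show "l e = \<zero>"
    proof (rule ccontr)
      assume le: "l e \<noteq> \<zero>"
      then have "e \<in> I" using l e by blast
      then obtain D where D: "D \<in> cocircuits M" "D \<inter> I = {e}"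
        by (rule M.cocircuit_meets_indep_once[OF I])
      have lc: "l x \<in> carrier R" if "x \<in> ?E" for x using l that by (auto simp: thin_dependence_def Pi_iff)
      have eD: "e \<in> D" using D by blast
      have ne: "l e \<otimes> f e D \<noteq> \<zero>" using integral[OF _ lc[OF e], of "f e D"] le eD by (auto simp: f_def)
      \<comment> \<open>As \<open>D\<close> meets \<open>I\<close> only in \<open>e\<close>, the
        equation at \<open>D\<close> has a single nonzero summand, which cannot vanish.\<close>
      have S: "{x \<in> ?E. l x \<otimes> f x D \<noteq> \<zero>} = {e}"
      proof (intro equalityI subsetI)
        fix x assume x: "x \<in> {x \<in> ?E. l x \<otimes> f x D \<noteq> \<zero>}"
        then have "l x \<noteq> \<zero>" using l_null[OF f_closed] by auto
        then have "x \<in> I" using l x by blast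
        moreover have "x \<in> D" using x lc[of x] by (auto simp: f_def split: if_splits)
        ultimately show "x \<in> {e}" using D by blast
      qed (use e ne in simp)
      have "(\<Oplus>x\<in>{x \<in> ?E. l x \<otimes> f x D \<noteq> \<zero>}. l x \<otimes> f x D) = \<zero>"
        using l D(1) by (simp add: thin_dependence_def)
      then have "(\<Oplus>x\<in>{e}. l x \<otimes> f x D) = \<zero>" unfolding S .
      then show False using ne lc[OF e] f_closed by simp
    qed
  qed
  moreover have "I \<in> indep M" if I: "thinly_independent R ?E (cocircuits M) f I" for I
  proof (rule ccontr)
    assume "I \<notin> indep M"
    moreover have Ig: "I \<subseteq> ?E" using I by (simp add: thinly_independent_def)
    ultimately obtain C where C: "C \<in> circuits M" "C \<subseteq> I"
      using M.dependent_contains_circuit by metis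
    define l where "l x = (if x \<in> C then field_sign R (c C x) else \<zero>)" for x
    have "thin_dependence R ?E (cocircuits M) f l"
      unfolding thin_dependence_def
    proof (intro conjI ballI)
      show "l \<in> ?E \<rightarrow> carrier R" by (simp add: l_def)
      fix D assume D: "D \<in> cocircuits M"
      have fin: "finite (C \<inter> D)" and sum0: "(\<Sum>e\<in>C \<inter> D. c C e * d D e) = 0" using orth C D by auto
      have cd: "c C x \<in> {1, -1}" "d D x \<in> {1, -1}" if "x \<in> C \<inter> D" for x using that c d C D by blast+
      have lf: "l x \<otimes> f x D = field_sign R (c C x * d D x)" if "x \<in> C \<inter> D" for x
        using that field_sign_mult[OF cd[OF that]] by (simp add: l_def f_def)
      have S: "{x \<in> ?E. l x \<otimes> f x D \<noteq> \<zero>} = C \<inter> D"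
      proof (intro equalityI subsetI)
        fix x assume "x \<in> {x \<in> ?E. l x \<otimes> f x D \<noteq> \<zero>}"
        then show "x \<in> C \<inter> D" by (auto simp: l_def f_def split: if_splits)
      qed (use lf M.circuit_subset_ground[OF C(1)] in auto)
      show "finite {x \<in> ?E. l x \<otimes> f x D \<noteq> \<zero>}" using S fin by simp
      have "(\<Oplus>x\<in>C \<inter> D. l x \<otimes> f x D) = (\<Oplus>x\<in>C \<inter> D. field_sign R (c C x * d D x))"
        using lf by (intro finsum_cong') auto
      also have "\<dots> = add_pow R (\<Sum>x\<in>C \<inter> D. c C x * d D x) \<one>"
        by (rule finsum_field_sign[OF fin]) (use cd in fastforce)
      also have "\<dots> = \<zero>" using sum0 by (simp add: add_pow_int_ge)
      finally show "(\<Oplus>x\<in>{x \<in> ?E. l x \<otimes> f x D \<noteq> \<zero>}. l x \<otimes> f x D) = \<zero>" unfolding S .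
    qed
    moreover have "\<forall>e\<in>?E - I. l e = \<zero>" using C(2) by (auto simp: l_def)
    ultimately have l0: "\<forall>e\<in>?E. l e = \<zero>" using I unfolding thinly_independent_def by blast
    obtain e where e: "e \<in> C" using M.circuit_nonempty[OF C(1)] by blast
    then have "l e = \<zero>" using l0 M.circuit_subset_ground[OF C(1)] by blast
    then show False using e by (simp add: l_def)
  qed
  ultimately have "indep M = {I. thinly_independent R ?E (cocircuits M) f I}" by blast
  then show ?thesis using f_closed by (intro thin_sums_overI) auto
qed

lemma representable_over_if_thin_sums_over:
  fixes M :: "'e set_system" and k :: "'k ring"
  assumes k: "field k" and fin: "finite (ground M)" and thin: "thin_sums_over k M"
  shows "representable_over k M"
proof -
  interpret field k by (rule k)
  let ?E = "ground M"
  obtain A :: "('e \<Rightarrow> 'k) set" and f where f: "\<forall>e\<in>?E. \<forall>a\<in>A. f e a \<in> carrier k"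
    and ind: "indep M = {I. thinly_independent k ?E A f I}"
    using thin unfolding thin_sums_over_def by blast
  define V :: "('k, ('e \<Rightarrow> 'k) \<Rightarrow> 'k) module" where
    "V = \<lparr>carrier = {g. \<forall>a. g a \<in> carrier k}, monoid.mult = undefined, one = undefined,
      zero = (\<lambda>a. \<zero>\<^bsub>k\<^esub>), add = (\<lambda>g g' a. g a \<oplus>\<^bsub>k\<^esub> g' a), smult = (\<lambda>x g a. x \<otimes>\<^bsub>k\<^esub> g a)\<rparr>"
  have V_simps: "carrier V = {g. \<forall>a. g a \<in> carrier k}" "\<zero>\<^bsub>V\<^esub> = (\<lambda>a. \<zero>\<^bsub>k\<^esub>)"
    "g \<oplus>\<^bsub>V\<^esub> g' = (\<lambda>a. g a \<oplus>\<^bsub>k\<^esub> g' a)" "x \<odot>\<^bsub>V\<^esub> g = (\<lambda>a. x \<otimes>\<^bsub>k\<^esub> g a)" for g g' x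
    by (simp_all add: V_def)
  have V: "Module.module k V"
  proof (rule Module.moduleI)
    show "cring k" by (rule is_cring)
    show "abelian_group V"
    proof (rule abelian_groupI)
      fix g assume "g \<in> carrier V"
      then show "\<exists>g'\<in>carrier V. g' \<oplus>\<^bsub>V\<^esub> g = \<zero>\<^bsub>V\<^esub>"
        by (intro bexI[of _ "\<lambda>a. \<ominus>\<^bsub>k\<^esub> g a"]) (auto simp: V_simps l_neg)
    qed (auto simp: V_simps a_ac)
  qed (auto simp: V_simps l_distr r_distr m_assoc)
  interpret V: Module.module k V by (rule V)
  \<comment> \<open>Vectors are functions on the whole type, zero outside \<open>A\<close>, so that
    equality with the zero vector is equality of functions.\<close>
  define v where "v e = (\<lambda>a. if e \<in> ?E \<and> a \<in> A then f e a else \<zero>\<^bsub>k\<^esub>)" for e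
  have v_closed: "v e a \<in> carrier k" for e a using f by (simp add: v_def)
  have finsum_V: "finsum V g J a = (\<Oplus>\<^bsub>k\<^esub>e\<in>J. g e a)" if "finite J" "g \<in> J \<rightarrow> carrier V" for g J a
    using that
  proof (induction J rule: finite_induct)
    case (insert x J)
    then show ?case by (simp add: V_simps Pi_iff)
  qed (simp add: V_simps)
  have comb: "(\<Oplus>\<^bsub>V\<^esub>e\<in>J. c e \<odot>\<^bsub>V\<^esub> v e) a = (\<Oplus>\<^bsub>k\<^esub>e\<in>J. c e \<otimes>\<^bsub>k\<^esub> v e a)"
    if "finite J" "c \<in> J \<rightarrow> carrier k" for J c a
    by (subst finsum_V[OF that(1)]) (use that(2) v_closed in \<open>auto simp: V_simps Pi_iff\<close>)
  have sum_eq: "(\<Oplus>\<^bsub>k\<^esub>e\<in>{e \<in> ?E. l e \<otimes>\<^bsub>k\<^esub> f e a \<noteq> \<zero>\<^bsub>k\<^esub>}. l e \<otimes>\<^bsub>k\<^esub> f e a) = (\<Oplus>\<^bsub>k\<^esub>e\<in>J. c e \<otimes>\<^bsub>k\<^esub> v e a)"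
    if J: "J \<subseteq> ?E" and c: "c \<in> J \<rightarrow> carrier k" and lc: "\<And>e. e \<in> J \<Longrightarrow> l e = c e"
      and l0: "\<And>e. e \<in> ?E - J \<Longrightarrow> l e = \<zero>\<^bsub>k\<^esub>" and a: "a \<in> A" for J c l a
  proof (rule add.finprod_mono_neutral_cong_left)
    show "finite J" by (rule finite_subset[OF J fin])
    have vf: "v e a = f e a" if "e \<in> ?E" for e using that a by (simp add: v_def)
    show sub: "{e \<in> ?E. l e \<otimes>\<^bsub>k\<^esub> f e a \<noteq> \<zero>\<^bsub>k\<^esub>} \<subseteq> J"
    proof
      fix e assume e: "e \<in> {e \<in> ?E. l e \<otimes>\<^bsub>k\<^esub> f e a \<noteq> \<zero>\<^bsub>k\<^esub>}"
      then have "l e \<noteq> \<zero>\<^bsub>k\<^esub>" using f a by auto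
      then show "e \<in> J" using l0 e by blast
    qed
    show "c e \<otimes>\<^bsub>k\<^esub> v e a = \<zero>\<^bsub>k\<^esub>" if e: "e \<in> J - {e \<in> ?E. l e \<otimes>\<^bsub>k\<^esub> f e a \<noteq> \<zero>\<^bsub>k\<^esub>}" for e
    proof -
      have "e \<in> ?E" "l e = c e" using e J lc by blast+
      then show ?thesis using e vf by auto
    qed
    show "l e \<otimes>\<^bsub>k\<^esub> f e a = c e \<otimes>\<^bsub>k\<^esub> v e a" if e: "e \<in> {e \<in> ?E. l e \<otimes>\<^bsub>k\<^esub> f e a \<noteq> \<zero>\<^bsub>k\<^esub>}" for e
    proof -
      have "e \<in> J" using sub e by blast
      then show ?thesis using e vf lc by simp
    qed
    show "(\<lambda>e. c e \<otimes>\<^bsub>k\<^esub> v e a) \<in> J \<rightarrow> carrier k" using c v_closed by (auto simp: Pi_iff)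
  qed
  have "thinly_independent k ?E A f I \<longleftrightarrow> linearly_independent k V v I" if I: "I \<subseteq> ?E" for I
  proof
    assume thi: "thinly_independent k ?E A f I"
    show "linearly_independent k V v I"
      unfolding linearly_independent_def
    proof (intro allI impI, elim conjE)
      fix J c assume J: "J \<subseteq> I" "finite J" and c: "c \<in> J \<rightarrow> carrier k"
        and s: "(\<Oplus>\<^bsub>V\<^esub>e\<in>J. c e \<odot>\<^bsub>V\<^esub> v e) = \<zero>\<^bsub>V\<^esub>"
      define l where "l e = (if e \<in> J then c e else \<zero>\<^bsub>k\<^esub>)" for e
      have "(\<Oplus>\<^bsub>k\<^esub>e\<in>{e \<in> ?E. l e \<otimes>\<^bsub>k\<^esub> f e a \<noteq> \<zero>\<^bsub>k\<^esub>}. l e \<otimes>\<^bsub>k\<^esub> f e a) = \<zero>\<^bsub>k\<^esub>" if a: "a \<in> A" for a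
      proof -
        have "(\<Oplus>\<^bsub>k\<^esub>e\<in>{e \<in> ?E. l e \<otimes>\<^bsub>k\<^esub> f e a \<noteq> \<zero>\<^bsub>k\<^esub>}. l e \<otimes>\<^bsub>k\<^esub> f e a) = (\<Oplus>\<^bsub>k\<^esub>e\<in>J. c e \<otimes>\<^bsub>k\<^esub> v e a)"
          by (rule sum_eq[OF _ c _ _ a]) (use J I in \<open>auto simp: l_def\<close>)
        also have "\<dots> = \<zero>\<^bsub>k\<^esub>" using comb[OF J(2) c, of a] s by (simp add: V_simps)
        finally show ?thesis .
      qed
      moreover have "l \<in> ?E \<rightarrow> carrier k" using c by (auto simp: l_def Pi_iff)
      ultimately have "thin_dependence k ?E A f l" using fin by (simp add: thin_dependence_def)
      moreover have "\<forall>e\<in>?E - I. l e = \<zero>\<^bsub>k\<^esub>" using J(1) by (auto simp: l_def)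
      ultimately have "\<forall>e\<in>?E. l e = \<zero>\<^bsub>k\<^esub>" using thi unfolding thinly_independent_def by blast
      then show "\<forall>e\<in>J. c e = \<zero>\<^bsub>k\<^esub>" using J(1) I by (force simp: l_def)
    qed
  next
    assume lin: "linearly_independent k V v I"
    show "thinly_independent k ?E A f I"
      unfolding thinly_independent_def
    proof (intro conjI allI impI, rule I, elim conjE)
      fix l assume l: "thin_dependence k ?E A f l" and l0: "\<forall>e\<in>?E - I. l e = \<zero>\<^bsub>k\<^esub>"
      have finI: "finite I" by (rule finite_subset[OF I fin])
      have lc: "l \<in> I \<rightarrow> carrier k" using l I by (auto simp: thin_dependence_def Pi_iff)
      have "(\<Oplus>\<^bsub>V\<^esub>e\<in>I. l e \<odot>\<^bsub>V\<^esub> v e) a = \<zero>\<^bsub>k\<^esub>" for a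
      proof (cases "a \<in> A")
        case True
        have "(\<Oplus>\<^bsub>k\<^esub>e\<in>I. l e \<otimes>\<^bsub>k\<^esub> v e a) =
            (\<Oplus>\<^bsub>k\<^esub>e\<in>{e \<in> ?E. l e \<otimes>\<^bsub>k\<^esub> f e a \<noteq> \<zero>\<^bsub>k\<^esub>}. l e \<otimes>\<^bsub>k\<^esub> f e a)"
          by (rule sum_eq[OF I lc _ _ True, symmetric]) (use l0 in auto)
        then show ?thesis using l True by (simp add: comb[OF finI lc] thin_dependence_def)
      next
        case False
        have "(\<Oplus>\<^bsub>k\<^esub>e\<in>I. l e \<otimes>\<^bsub>k\<^esub> v e a) = (\<Oplus>\<^bsub>k\<^esub>e\<in>I. \<zero>\<^bsub>k\<^esub>)"
          using False lc by (intro finsum_cong') (auto simp: v_def Pi_iff)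
        then show ?thesis by (simp add: comb[OF finI lc])
      qed
      then have "(\<Oplus>\<^bsub>V\<^esub>e\<in>I. l e \<odot>\<^bsub>V\<^esub> v e) = \<zero>\<^bsub>V\<^esub>" by (auto simp: V_simps)
      then have "\<forall>e\<in>I. l e = \<zero>\<^bsub>k\<^esub>"
        using lin[unfolded linearly_independent_def, THEN spec, THEN spec, of I l] finI lc by blast
      then show "\<forall>e\<in>?E. l e = \<zero>\<^bsub>k\<^esub>" using l0 by blast
    qed
  qed
  then have "indep M = {I. I \<subseteq> ?E \<and> linearly_independent k V v I}"
    unfolding ind by (auto simp: thinly_independent_def)
  moreover have "v \<in> ?E \<rightarrow> carrier V" using v_closed by (simp add: V_simps)
  ultimately show ?thesis using representable_overI[OF fin V] by blast
qed

text \<open>Both converse directions end here: the modular signings of a finite minor may be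
  inherited from \<open>M\<close> or come from representations of the minor itself.\<close>

lemma signable_if_finite_minors_signable_mod_2_3:
  assumes M: "matroid M" and tame: "tame M"
    and minors: "\<And>N. is_minor N M \<Longrightarrow> finite (ground N) \<Longrightarrow> signable_mod 2 N \<and> signable_mod 3 N"
  shows "signable M"
proof (rule matroid.signable_if_finite_minors_signable[OF M tame])
  fix N assume N: "is_minor N M" "finite (ground N)"
  then have "matroid N" using is_minorE[OF M] matroid_minor.matroid_N by metis
  then show "signable N"
    using minors[OF N] N(2) matroid.signable_if_signable_mod_2_3 by blast
qed

theorem theorem5p2:
  fixes M :: "'e set_system"
  assumes "matroid M" and "tame M"
    and "infinite (UNIV :: 'k set)"
  shows "((\<forall>k :: 'k ring. field k \<longrightarrow> thin_sums_over k M) \<longleftrightarrow> signable M) \<and>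
    (signable M \<longleftrightarrow>
      (\<forall>N. is_minor N M \<and> finite (ground N) \<longrightarrow> regular TYPE('k) N))"
proof -
  note M = assms(1)
  \<comment> \<open>An infinite \<open>'k\<close> has room for carriers with two and with three
    elements.\<close>
  obtain h2 :: "2 \<Rightarrow> 'k" where "inj h2" using inj_into_infinite[OF assms(3)] by blast
  then interpret F2: unit_field_copy h2 by (intro unit_field_copy.intro unit_cases_2)
  obtain h3 :: "3 \<Rightarrow> 'k" where "inj h3" using inj_into_infinite[OF assms(3)] by blast
  then interpret F3: unit_field_copy h3 by (intro unit_field_copy.intro unit_cases_3)
  have matroid_minor: "matroid N" if "is_minor N M" for N
    using is_minorE[OF M that] matroid_minor.matroid_N by metis
  have signable_mod_minor: "signable_mod q N" if "is_minor N M" "signable_mod q M" for N q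
    using is_minorE[OF M that(1)] matroid_minor.signable_mod_minor that(2) by metis
  have "signable M" if thin: "\<forall>k :: 'k ring. field k \<longrightarrow> thin_sums_over k M"
  proof -
    \<comment> \<open>What is passed on to the minors is the modular signing of \<open>M\<close>,
      not the thin sums representation.\<close>
    have "signable_mod 2 M"
      by (rule F2.signable_mod_if_thin_sums[OF M assms(2) of_int_eq_0_iff_2])
        (use thin F2.field_copy in blast)
    moreover have "signable_mod 3 M"
      by (rule F3.signable_mod_if_thin_sums[OF M assms(2) of_int_eq_0_iff_3])
        (use thin F3.field_copy in blast)
    ultimately show ?thesis
      using signable_if_finite_minors_signable_mod_2_3[OF M assms(2)] signable_mod_minor by blast
  qed
  moreover have "signable M"
    if regular: "\<forall>N. is_minor N M \<and> finite (ground N) \<longrightarrow> regular TYPE('k) N"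
  proof (rule signable_if_finite_minors_signable_mod_2_3[OF M assms(2)])
    fix N assume N: "is_minor N M" "finite (ground N)"
    then have rep: "representable_over k N" if "field k" for k :: "'k ring"
      using regular that unfolding regular_def by blast
    have "signable_mod 2 N"
      by (rule F2.signable_mod_if_representable[OF matroid_minor[OF N(1)] N(2) of_int_eq_0_iff_2])
        (rule rep[OF F2.field_copy])
    moreover have "signable_mod 3 N"
      by (rule F3.signable_mod_if_representable[OF matroid_minor[OF N(1)] N(2) of_int_eq_0_iff_3])
        (rule rep[OF F3.field_copy])
    ultimately show "signable_mod 2 N \<and> signable_mod 3 N" ..
  qed
  moreover have "thin_sums_over k M" if "signable M" "field k" for k :: "'k ring"
    using thin_sums_over_if_signable[OF that(2) M that(1)] .
  moreover have "regular TYPE('k) N" if s: "signable M" and N: "is_minor N M" "finite (ground N)" for N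
    unfolding regular_def
  proof (intro conjI allI impI N(2))
    fix k :: "'k ring" assume k: "field k"
    have "signable N" using signable_mod_minor[OF N(1)] s by (simp add: signable_iff_mod_0)
    then have "thin_sums_over k N" by (rule thin_sums_over_if_signable[OF k matroid_minor[OF N(1)]])
    then show "representable_over k N" by (rule representable_over_if_thin_sums_over[OF k N(2)])
  qed
  ultimately show ?thesis by blast
qed

end
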